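(* Let $(\Omega,\Sigma,\mu)$ be a finite, positive, non-atomic measure space with $\mu(\Omega)>0$, let $X,Y$ be Banach spaces, and let $0\le\sigma<1$. A continuous linear operator $u:X\to Y$ is $(1,\sigma)$-absolutely continuous if and only if the composition operator $\tilde u:\mathcal P_{1/(1-\sigma)}^\sigma(\mu,X)\to\mathcal B_{1/(1-\sigma)}(\mu,Y)$, $\tilde u(f):=u\circ f$, is well defined and continuous.
   Context: For $1\le p<\infty$, $\mathcal P_p(\mu,X)$ is the space of ($\mu$-a.e. classes of) strongly measurable Pettis $p$-integrable functions $f:\Omega\to X$ (Pettis integrable with $x'\circ f\in L^p(\mu)$ for all $x'\in X^*$) with norm $\|f\|_{\mathcal P_p}=\sup_{x'\in B_{X^*}}(\int|x'(f(w))|^p\,d\mu(w))^{1/p}$. $\mathcal B_p(\mu,Y)$ is the space of Bochner $p$-integrable functions $f:\Omega\to Y$ with norm $(\int\|f(w)\|^p\,d\mu(w))^{1/p}$. For $1\le p<\infty$, $0\le\sigma\le1$ let $\mathcal S_p^\sigma(\mu,X)$ be the space of $\mu$-classes of $X$-valued simple functions. For such $f$ put $$\Phi_{p,\sigma}(f)=\sup_{x'\in B_{X^*}}\Big(\int\big(|\langle f(w),x'\rangle|^{1-\sigma}\|f(w)\|^\sigma\big)^p\,d\mu(w)\Big)^{1/p}$$ and $\|f\|_{p,\sigma}=\inf\{\sum_{i=1}^n\Phi_{p,\sigma}(f_i): f=\sum_{i=1}^n f_i,\ f_i\in\mathcal S_p^\sigma(\mu,X)\}$. This is a norm with $\|\cdot\|_{\mathcal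 P_p}\le\|\cdot\|_{p,\sigma}$. Define $\mathcal P_p^\sigma(\mu,X):=\overline{\mathcal S_p^\sigma(\mu,X)}\cap\mathcal P_p(\mu,X)$, where $\overline{\mathcal S_p^\sigma(\mu,X)}$ is the completion for $\|\cdot\|_{p,\sigma}$, with the norm induced by that completion; concretely, it consists of those $f\in\mathcal P_p(\mu,X)$ for which there is a $\|\cdot\|_{p,\sigma}$-Cauchy sequence $(f_n)$ of simple functions converging to $f$ in $\|\cdot\|_{\mathcal P_p}$, and the norm of $f$ is the infimum of $\lim_n\|f_n\|_{p,\sigma}$ over such sequences. For $1\le p<\infty$ and $0\le\sigma<1$, a linear operator $T:X\to Y$ is $(p,\sigma)$-absolutely continuous if there is $C>0$ such that for all finite families $x_1,\dots,x_n\in X$, $$\Big(\sum_{i=1}^n\|T(x_i)\|^{\frac p{1-\sigma}}\Big)^{\frac{1-\sigma}p}\le C\sup_{x'\in B_{X^*}}\Big(\sum_{i=1}^n\big(|\langle x_i,x'\rangle|^{1-\sigma}\|x_i\|^\sigma\big)^{\frac p{1-\sigma}}\Big)^{\frac{1-\sigma}p}.$$ "Well defined" means $u\circ f\in\mathcal B_{1/(1-\sigma)}(\mu,Y)$ for every $f$ in the domain. *)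

theory Defs
  imports "HOL-Analysis.Analysis"
begin

text \<open>
  Spaces of \<open>\<mu>\<close>-classes of vector-valued functions are represented by predicates/sets of
  functions together with their seminorms; all notions below are invariant under changing a
  function on a null set (within the Borel measurable functions). Scalars are real, and the
  dual space of \<open>X\<close> is the type \<open>X \<Rightarrow>\<^sub>L real\<close>.
\<close>

definition nonatomic :: "'w measure \<Rightarrow> bool" where
  "nonatomic M \<longleftrightarrow> (\<forall>A\<in>sets M. emeasure M A > 0 \<longrightarrow>
     (\<exists>B\<in>sets M. B \<subseteq> A \<and> 0 < emeasure M B \<and> emeasure M B < emeasure M A))"

text \<open>
  A \<open>\<mu>\<close>-a.e. limit of simple functions. Borel measurability is automatic if \<open>M\<close> is complete;
  in general it only selects suitable representatives: each a.e. limit of simple functions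
  agrees a.e. with a Borel measurable one.
\<close>

definition strongly_measurable :: "'w measure \<Rightarrow> ('w \<Rightarrow> 'a::real_normed_vector) \<Rightarrow> bool" where
  "strongly_measurable M f \<longleftrightarrow> f \<in> borel_measurable M \<and>
     (\<exists>s. (\<forall>n. simple_function M (s n)) \<and> (AE w in M. (\<lambda>n. s n w) \<longlonglongrightarrow> f w))"

definition pettis_integrable :: "'w measure \<Rightarrow> ('w \<Rightarrow> 'a::real_normed_vector) \<Rightarrow> bool" where
  "pettis_integrable M f \<longleftrightarrow>
     (\<forall>x' :: 'a \<Rightarrow>\<^sub>L real. integrable M (\<lambda>w. x' (f w))) \<and>
     (\<forall>A\<in>sets M. \<exists>x. \<forall>x' :: 'a \<Rightarrow>\<^sub>L real. x' x = (LINT w:A|M. x' (f w)))"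

definition pettis_space :: "real \<Rightarrow> 'w measure \<Rightarrow> ('w \<Rightarrow> 'a::real_normed_vector) set" where
  "pettis_space p M = {f. strongly_measurable M f \<and> pettis_integrable M f \<and>
     (\<forall>x' :: 'a \<Rightarrow>\<^sub>L real. integrable M (\<lambda>w. \<bar>x' (f w)\<bar> powr p))}"

text \<open>
  On \<open>pettis_space p M\<close> the inner integrals are finite, so that the values in \<open>ennreal\<close>
  serve only to make the supremum meaningful without a prior proof of boundedness.
\<close>

definition pettis_norm :: "real \<Rightarrow> 'w measure \<Rightarrow> ('w \<Rightarrow> 'a::real_normed_vector) \<Rightarrow> ennreal" where
  "pettis_norm p M f = (SUP x'\<in>cball (0 :: 'a \<Rightarrow>\<^sub>L real) 1.
     ennreal ((LINT w|M. \<bar>blinfun_apply x' (f w)\<bar> powr p) powr (1 / p)))"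

definition bochner_space :: "real \<Rightarrow> 'w measure \<Rightarrow> ('w \<Rightarrow> 'b::real_normed_vector) set" where
  "bochner_space p M = {f. strongly_measurable M f \<and> integrable M (\<lambda>w. norm (f w) powr p)}"

definition bochner_norm :: "real \<Rightarrow> 'w measure \<Rightarrow> ('w \<Rightarrow> 'b::real_normed_vector) \<Rightarrow> real" where
  "bochner_norm p M f = (LINT w|M. norm (f w) powr p) powr (1 / p)"

text \<open>
  The following is applied to simple functions on a finite measure space and for
  \<open>0 \<le> \<sigma> < 1\<close> only. There the integrals exist and the supremum is that of a nonempty bounded
  set. The convention \<open>0 powr 0 = 0\<close> is harmless, since for \<open>f w = 0\<close> the first factor of the
  integrand vanishes anyway.
\<close>

definition Phi :: "real \<Rightarrow> real \<Rightarrow> 'w measure \<Rightarrow> ('w \<Rightarrow> 'a::real_normed_vector) \<Rightarrow> real" where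
  "Phi p \<sigma> M f = (SUP x'\<in>cball (0 :: 'a \<Rightarrow>\<^sub>L real) 1.
     (LINT w|M. (\<bar>blinfun_apply x' (f w)\<bar> powr (1 - \<sigma>) * norm (f w) powr \<sigma>) powr p) powr (1 / p))"

definition simple_norm :: "real \<Rightarrow> real \<Rightarrow> 'w measure \<Rightarrow> ('w \<Rightarrow> 'a::real_normed_vector) \<Rightarrow> real" where
  "simple_norm p \<sigma> M f = Inf {\<Sum>i<n. Phi p \<sigma> M (g i) | (n::nat) g.
     (\<forall>i<n. simple_function M (g i)) \<and> (AE w in M. f w = (\<Sum>i<n. g i w))}"

definition approximates ::
    "real \<Rightarrow> real \<Rightarrow> 'w measure \<Rightarrow> (nat \<Rightarrow> 'w \<Rightarrow> 'a::real_normed_vector) \<Rightarrow> ('w \<Rightarrow> 'a) \<Rightarrow> bool" where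
  "approximates p \<sigma> M s f \<longleftrightarrow>
     (\<forall>n. simple_function M (s n)) \<and>
     (\<forall>e>0. \<exists>N. \<forall>m\<ge>N. \<forall>n\<ge>N. simple_norm p \<sigma> M (\<lambda>w. s m w - s n w) < e) \<and>
     (\<lambda>n. pettis_norm p M (\<lambda>w. s n w - f w)) \<longlonglongrightarrow> 0"

definition pettis_sigma_space ::
    "real \<Rightarrow> real \<Rightarrow> 'w measure \<Rightarrow> ('w \<Rightarrow> 'a::real_normed_vector) set" where
  "pettis_sigma_space p \<sigma> M = {f \<in> pettis_space p M. \<exists>s. approximates p \<sigma> M s f}"

definition pettis_sigma_norm ::
    "real \<Rightarrow> real \<Rightarrow> 'w measure \<Rightarrow> ('w \<Rightarrow> 'a::real_normed_vector) \<Rightarrow> real" where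
  "pettis_sigma_norm p \<sigma> M f =
     Inf {L. \<exists>s. approximates p \<sigma> M s f \<and> (\<lambda>n. simple_norm p \<sigma> M (s n)) \<longlonglongrightarrow> L}"

definition absolutely_continuous_op ::
    "real \<Rightarrow> real \<Rightarrow> ('a::real_normed_vector \<Rightarrow> 'b::real_normed_vector) \<Rightarrow> bool" where
  "absolutely_continuous_op p \<sigma> T \<longleftrightarrow> linear T \<and>
     (\<exists>C>0. \<forall>n (x :: nat \<Rightarrow> 'a).
        (\<Sum>i<n. norm (T (x i)) powr (p / (1 - \<sigma>))) powr ((1 - \<sigma>) / p)
        \<le> C * (SUP x'\<in>cball (0 :: 'a \<Rightarrow>\<^sub>L real) 1.
             (\<Sum>i<n. (\<bar>blinfun_apply x' (x i)\<bar> powr (1 - \<sigma>) * norm (x i) powr \<sigma>) powr (p / (1 - \<sigma>)))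
               powr ((1 - \<sigma>) / p)))"

text \<open>
  Continuity, at every point of \<open>S\<close>, of an operator on function spaces with respect to the
  distances given by the (semi)norms \<open>N\<close> and \<open>N'\<close>.
\<close>

definition norm_continuous_on ::
    "('w \<Rightarrow> 'a::real_normed_vector) set \<Rightarrow> (('w \<Rightarrow> 'a) \<Rightarrow> real) \<Rightarrow>
     (('w \<Rightarrow> 'b::real_normed_vector) \<Rightarrow> real) \<Rightarrow> (('w \<Rightarrow> 'a) \<Rightarrow> ('w \<Rightarrow> 'b)) \<Rightarrow> bool" where
  "norm_continuous_on S N N' T \<longleftrightarrow>
     (\<forall>f\<in>S. \<forall>e>0. \<exists>d>0. \<forall>g\<in>S. N (\<lambda>w. g w - f w) < d \<longrightarrow> N' (\<lambda>w. T g w - T f w) < e)"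

end

theory Submission
  imports Defs
begin

text \<open>
  Put \<open>p = 1 / (1 - \<sigma>)\<close>. Both integrands \<open>norm (u v) powr p\<close> and
  \<open>(\<bar>x' v\<bar> powr (1 - \<sigma>) * norm v powr \<sigma>) powr p\<close> are positively homogeneous of degree \<open>p\<close>, so the measure
  of a level set can be absorbed into the vector; as there are arbitrarily many disjoint sets of
  positive measure, absolute continuity with constant \<open>C\<close> amounts to
  \<open>bochner_norm p M (u \<circ> f) \<le> C * Phi p \<sigma> M f\<close> for simple \<open>f\<close>. Continuity at \<open>0\<close> implies this by
  homogeneity. Conversely the bound passes from \<open>Phi\<close> to \<open>simple_norm\<close> by Minkowski's inequality, and
  to a limit \<open>f\<close> of simple functions \<open>s n\<close> by Fatou's lemma: along a subsequence, convergence in the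
  Pettis norm gives a.e. convergence of \<open>x' (s n w)\<close> for countably many \<open>x'\<close>, which by Hahn-Banach
  determine the norm of \<open>u (f w)\<close>.
\<close>

subsection \<open>Norming functionals\<close>

text \<open>Only one inequality is asked for positive scalars, so that infima need only be checked
  in one direction. Equality follows by scaling back with \<open>1 / c\<close>, and the value at 0
  by comparing \<open>q 0\<close> with \<open>2 * q 0\<close>.\<close>

definition sublinear :: "('a::real_vector \<Rightarrow> real) \<Rightarrow> bool" where
  "sublinear q \<longleftrightarrow> (\<forall>x y. q (x + y) \<le> q x + q y) \<and> (\<forall>c>0. \<forall>x. q (c *\<^sub>R x) \<le> c * q x)"

lemma sublinear_add: "sublinear q \<Longrightarrow> q (x + y) \<le> q x + q y"
  by (simp add: sublinear_def)

lemma sublinear_scale: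
  assumes "sublinear q" "c > 0"
  shows "q (c *\<^sub>R x) = c * q x"
proof (rule antisym)
  show "q (c *\<^sub>R x) \<le> c * q x" using assms by (simp add: sublinear_def)
  have "q ((1 / c) *\<^sub>R (c *\<^sub>R x)) \<le> (1 / c) * q (c *\<^sub>R x)"
    using assms unfolding sublinear_def by (metis zero_less_divide_1_iff)
  with assms show "c * q x \<le> q (c *\<^sub>R x)" by (simp add: field_simps)
qed

lemma sublinear_0: "sublinear q \<Longrightarrow> q 0 = 0"
  using sublinear_scale[of q 2 0] by simp

lemma sublinear_minus: "sublinear q \<Longrightarrow> - q (- x) \<le> q x"
  using sublinear_add[of q x "- x"] sublinear_0[of q] by simp

text \<open>For minimal \<open>q\<close> this forces additivity; for \<open>q = norm\<close> it makes every linear minorant norming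
  at \<open>y\<close>.\<close>

lemma sublinear_decrease:
  fixes q :: "'a::real_vector \<Rightarrow> real"
  assumes q: "sublinear q"
  obtains r where "sublinear r" "\<And>x. r x \<le> q x" "\<And>x. r x \<le> q (x + y) - q y"
proof -
  \<comment> \<open>The largest sublinear functional below \<open>q\<close> whose value at
    \<open>- y\<close> is at most \<open>- q y\<close>, as in the one-step extension argument of
    Hahn-Banach. The choices \<open>t = 0\<close> and \<open>t = 1\<close> give the two required
    upper bounds.\<close>
  define r where "r x = (INF t\<in>{0..}. q (x + t *\<^sub>R y) - t * q y)" for x
  \<comment> \<open>This lower bound does not depend on \<open>t\<close>, so the infimum is a
    genuine one.\<close>
  have lower: "- q (- x) \<le> q (x + t *\<^sub>R y) - t * q y" if "t \<ge> 0" for x t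
  proof -
    have "t * q y = q (t *\<^sub>R y)"
      using sublinear_scale[OF q, of t y] sublinear_0[OF q] that by (cases "t = 0") auto
    also have "\<dots> \<le> q (x + t *\<^sub>R y) + q (- x)"
      using sublinear_add[OF q, of "x + t *\<^sub>R y" "- x"] by simp
    finally show ?thesis by simp
  qed
  have upper: "r x \<le> q (x + t *\<^sub>R y) - t * q y" if "t \<ge> 0" for x t
    unfolding r_def using that lower by (intro cINF_lower bdd_belowI2[where m = "- q (- x)"]) auto
  have greatest: "m \<le> r x" if "\<And>t. t \<ge> 0 \<Longrightarrow> m \<le> q (x + t *\<^sub>R y) - t * q y" for m x
    unfolding r_def using that by (intro cINF_greatest) auto
  have add: "r (x + x') \<le> r x + r x'" for x x'
  proof -
    \<comment> \<open>The parameters \<open>s\<close> and \<open>t\<close> for the two summands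
      merge into the parameter \<open>s + t\<close> for the sum.\<close>
    have "r (x + x') - (q (x' + t *\<^sub>R y) - t * q y) \<le> r x" if t: "t \<ge> 0" for t
    proof (rule greatest)
      fix s :: real assume s: "s \<ge> 0"
      have "r (x + x') \<le> q ((x + x') + (s + t) *\<^sub>R y) - (s + t) * q y"
        using s t by (intro upper) simp
      moreover have "q ((x + x') + (s + t) *\<^sub>R y) \<le> q (x + s *\<^sub>R y) + q (x' + t *\<^sub>R y)"
        using sublinear_add[OF q, of "x + s *\<^sub>R y" "x' + t *\<^sub>R y"] by (simp add: algebra_simps)
      ultimately show "r (x + x') - (q (x' + t *\<^sub>R y) - t * q y) \<le> q (x + s *\<^sub>R y) - s * q y"
        by (simp add: algebra_simps)
    qed
    then have "r (x + x') - r x \<le> r x'" by (intro greatest) (smt (verit))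
    then show ?thesis by simp
  qed
  have scale: "r (c *\<^sub>R x) \<le> c * r x" if c: "c > 0" for c x
  proof -
    have "r (c *\<^sub>R x) / c \<le> r x"
    proof (rule greatest)
      fix t :: real assume t: "t \<ge> 0"
      have "r (c *\<^sub>R x) \<le> q (c *\<^sub>R x + (c * t) *\<^sub>R y) - (c * t) * q y"
        using c t by (intro upper) simp
      also have "q (c *\<^sub>R x + (c * t) *\<^sub>R y) = c * q (x + t *\<^sub>R y)"
        using sublinear_scale[OF q c, of "x + t *\<^sub>R y"] by (simp add: algebra_simps)
      finally show "r (c *\<^sub>R x) / c \<le> q (x + t *\<^sub>R y) - t * q y"
        using c by (simp add: field_simps)
    qed
    with c show ?thesis by (simp add: field_simps)
  qed
  show ?thesis
  proof (rule that[of r])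
    show "sublinear r" using add scale by (simp add: sublinear_def)
    show "r x \<le> q x" for x using upper[of 0 x] by simp
    show "r x \<le> q (x + y) - q y" for x using upper[of 1 x] by simp
  qed
qed

text \<open>Subadditivity gives \<open>- b (- x)\<close> as a common lower bound at
  \<open>x\<close>, so the infima are real. In a chain, two members can be replaced by the smaller
  one, to which subadditivity applies.\<close>

lemma sublinear_INF_chain:
  fixes C :: "('a::real_vector \<Rightarrow> real) set"
  assumes C: "C \<noteq> {}" "\<And>q. q \<in> C \<Longrightarrow> sublinear q"
    and chain: "\<And>q q'. q \<in> C \<Longrightarrow> q' \<in> C \<Longrightarrow> q \<le> q' \<or> q' \<le> q"
    and le: "\<And>q x. q \<in> C \<Longrightarrow> q x \<le> b x"
  shows "sublinear (\<lambda>x. INF q\<in>C. q x)" and "q \<in> C \<Longrightarrow> (INF q\<in>C. q x) \<le> q x"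
proof -
  have bdd: "bdd_below ((\<lambda>q. q x) ` C)" for x
  proof (rule bdd_belowI2)
    fix q assume "q \<in> C"
    then show "- b (- x) \<le> q x"
      using sublinear_minus[OF C(2), of q x] le[of q "- x"] by simp
  qed
  then show lower: "q \<in> C \<Longrightarrow> (INF q\<in>C. q x) \<le> q x" for q x by (rule cINF_lower)
  have "(INF q\<in>C. q (x + y)) \<le> (INF q\<in>C. q x) + (INF q\<in>C. q y)" for x y
  proof -
    have "(INF q\<in>C. q (x + y)) - q' y \<le> q x" if qq': "q \<in> C" "q' \<in> C" for q q'
    proof -
      obtain r where r: "r \<in> C" "r \<le> q" "r \<le> q'" using chain[OF qq'] qq' by blast
      have "(INF q\<in>C. q (x + y)) \<le> r (x + y)" using r(1) by (rule lower)
      also have "\<dots> \<le> r x + r y" using C(2)[OF r(1)] by (rule sublinear_add)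
      also have "\<dots> \<le> q x + q' y" using r(2,3) by (intro add_mono) (auto simp: le_fun_def)
      finally show ?thesis by simp
    qed
    then have "(INF q\<in>C. q (x + y)) - q' y \<le> (INF q\<in>C. q x)" if "q' \<in> C" for q'
      using that C(1) by (intro cINF_greatest) auto
    then have "(INF q\<in>C. q (x + y)) - (INF q\<in>C. q x) \<le> (INF q\<in>C. q y)"
      using C(1) by (intro cINF_greatest) (auto simp: algebra_simps)
    then show ?thesis by simp
  qed
  moreover have "(INF q\<in>C. q (c *\<^sub>R x)) \<le> c * (INF q\<in>C. q x)" if c: "c > 0" for c x
  proof -
    have "(INF q\<in>C. q (c *\<^sub>R x)) / c \<le> (INF q\<in>C. q x)"
    proof (rule cINF_greatest[OF C(1)])
      fix q assume q: "q \<in> C"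
      then show "(INF q\<in>C. q (c *\<^sub>R x)) / c \<le> q x"
        using lower[OF q, of "c *\<^sub>R x"] sublinear_scale[OF C(2)[OF q] c, of x] c
        by (simp add: field_simps)
    qed
    with c show ?thesis by (simp add: field_simps)
  qed
  ultimately show "sublinear (\<lambda>x. INF q\<in>C. q x)" by (simp add: sublinear_def)
qed

text \<open>Zorn's lemma for the reversed pointwise order: a nonempty chain is bounded by its
  pointwise infimum, the empty chain by \<open>p\<close> itself.\<close>

lemma ex_minimal_sublinear:
  fixes p :: "'a::real_vector \<Rightarrow> real"
  assumes "sublinear p"
  obtains q where "sublinear q" "q \<le> p" "\<And>r. sublinear r \<Longrightarrow> r \<le> q \<Longrightarrow> r = q"
proof -
  let ?A = "{q. sublinear q \<and> q \<le> p}"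
  have "\<exists>m\<in>?A. \<forall>a\<in>?A. a \<le> m \<longrightarrow> a = m"
  proof (rule predicate_Zorn)
    show "partial_order_on ?A (relation_of (\<lambda>q r. r \<le> q) ?A)"
      by (rule partial_order_on_relation_ofI) auto
    fix C assume C: "C \<in> Chains (relation_of (\<lambda>q r. r \<le> q) ?A)"
    then have sub: "C \<subseteq> ?A" by (auto simp: Chains_def relation_of_def)
    have chain: "q \<le> q' \<or> q' \<le> q" if "q \<in> C" "q' \<in> C" for q q'
      using C that by (auto simp: Chains_def relation_of_def)
    show "\<exists>u\<in>?A. \<forall>a\<in>C. u \<le> a"
    proof (cases "C = {}")
      case True
      with assms show ?thesis by auto
    next
      case False
      note inf = sublinear_INF_chain[of C p, OF False _ chain]
      have "sublinear (\<lambda>x. INF q\<in>C. q x)"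
        by (rule inf) (use sub in \<open>auto simp: le_fun_def\<close>)
      moreover have lower: "(INF q\<in>C. q x) \<le> q x" if "q \<in> C" for q x
        by (rule inf) (use sub that in \<open>auto simp: le_fun_def\<close>)
      moreover have "(INF q\<in>C. q x) \<le> p x" for x
        using False lower[of _ x] sub by (auto simp: le_fun_def intro: order_trans)
      ultimately show ?thesis
        by (intro bexI[of _ "\<lambda>x. INF q\<in>C. q x"]) (auto simp: le_fun_def)
    qed
  qed
  then show ?thesis using that by (auto intro: order_trans)
qed

lemma minimal_sublinear_imp_linear:
  fixes q :: "'a::real_vector \<Rightarrow> real"
  assumes q: "sublinear q" and min: "\<And>r. sublinear r \<Longrightarrow> r \<le> q \<Longrightarrow> r = q"
  shows "linear q"
proof -
  have add: "q (x + y) = q x + q y" for x y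
  proof -
    obtain r where r: "sublinear r" "\<And>x. r x \<le> q x" "\<And>x. r x \<le> q (x + y) - q y"
      using sublinear_decrease[OF q, of y] by blast
    then have "r = q" by (intro min) (auto simp: le_fun_def)
    with r(3)[of x] sublinear_add[OF q, of x y] show ?thesis by simp
  qed
  have minus: "q (- x) = - q x" for x using add[of x "- x"] sublinear_0[OF q] by simp
  have "q (c *\<^sub>R x) = c * q x" for c x
    using sublinear_scale[OF q, of c x] sublinear_scale[OF q, of "- c" x] sublinear_0[OF q]
      minus[of "c *\<^sub>R x"] by (cases c "0 :: real" rule: linorder_cases) auto
  with add show ?thesis by (intro linearI) auto
qed

text \<open>The norm is first decreased in the direction \<open>a\<close>. The decreased functional
  is at most \<open>- norm a\<close> at \<open>- a\<close>, and a minimal sublinear functional below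
  it is linear, so it takes the value \<open>norm a\<close> at \<open>a\<close>.\<close>

lemma ex_norming_functional:
  fixes a :: "'a::real_normed_vector"
  obtains x' :: "'a \<Rightarrow>\<^sub>L real" where "norm x' \<le> 1" "x' a = norm a"
proof -
  have "sublinear (norm :: 'a \<Rightarrow> real)" by (simp add: sublinear_def norm_triangle_ineq)
  then obtain p :: "'a \<Rightarrow> real" where p: "sublinear p" "\<And>x. p x \<le> norm x"
      "\<And>x. p x \<le> norm (x + a) - norm a"
    using sublinear_decrease[of norm a] by blast
  obtain q where q: "sublinear q" "q \<le> p" "\<And>r. sublinear r \<Longrightarrow> r \<le> q \<Longrightarrow> r = q"
    using ex_minimal_sublinear[OF p(1)] by blast
  then have lin: "linear q" by (intro minimal_sublinear_imp_linear)
  have le: "q x \<le> norm x" for x using q(2) p(2) by (auto simp: le_fun_def intro: order_trans)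
  have abs: "\<bar>q x\<bar> \<le> norm x" for x
    using le[of x] le[of "- x"] linear_neg[OF lin, of x] by simp
  have "bounded_linear q"
    using lin abs by (auto simp: bounded_linear_def bounded_linear_axioms_def intro: exI[of _ 1])
  then have app: "blinfun_apply (Blinfun q) = q" by (rule bounded_linear_Blinfun_apply)
  have "q (- a) \<le> - norm a" using q(2) p(3)[of "- a"] by (auto simp: le_fun_def intro: order_trans)
  then have "q a = norm a" using linear_neg[OF lin, of a] le[of a] by simp
  with app abs show ?thesis
    by (intro that[of "Blinfun q"] norm_blinfun_bound) auto
qed

subsection \<open>Minkowski's inequality and integrals of simple functions\<close>

text \<open>When \<open>x\<close> or \<open>y\<close> vanishes, the claim reduces to
  \<open>t powr p \<le> t\<close> for a weight \<open>t\<close> below 1; otherwise it is convexity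
  on the positive reals.\<close>

lemma convex_powr_nonneg:
  fixes x y u v p :: real
  assumes p: "1 \<le> p" and xy: "0 \<le> x" "0 \<le> y" and uv: "0 < u" "0 < v" "u + v = 1"
  shows "(u * x + v * y) powr p \<le> u * x powr p + v * y powr p"
proof -
  have powr_le: "t powr p \<le> t" if "0 < t" "t < 1" for t :: real
    using powr_mono'[of 1 p t] p that by simp
  consider "x = 0" | "y = 0" | "0 < x" "0 < y" using xy by linarith
  then show ?thesis
  proof cases
    case 1
    with powr_le[of v] uv xy show ?thesis by (simp add: powr_mult mult_right_mono)
  next
    case 2
    with powr_le[of u] uv xy show ?thesis by (simp add: powr_mult mult_right_mono)
  next
    case 3
    with convex_onD[OF powr_convex[OF p], of v x y] uv show ?thesis
      by (auto simp: eq_diff_eq[symmetric])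
  qed
qed

lemma Minkowski_inequality:
  fixes f g :: "'w \<Rightarrow> real"
  assumes p: "1 \<le> p"
    and meas: "f \<in> borel_measurable M" "g \<in> borel_measurable M"
    and int: "integrable M (\<lambda>w. \<bar>f w\<bar> powr p)" "integrable M (\<lambda>w. \<bar>g w\<bar> powr p)"
  shows "integrable M (\<lambda>w. \<bar>f w + g w\<bar> powr p)"
    and "(LINT w|M. \<bar>f w + g w\<bar> powr p) powr (1 / p) \<le>
      (LINT w|M. \<bar>f w\<bar> powr p) powr (1 / p) + (LINT w|M. \<bar>g w\<bar> powr p) powr (1 / p)"
proof -
  note [measurable] = meas
  \<comment> \<open>Convexity in place of Hoelder's inequality:
    \<open>\<bar>f w\<bar> + \<bar>g w\<bar>\<close> is \<open>a + b\<close> times the convex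
    combination of \<open>\<bar>f w\<bar> / a\<close> and \<open>\<bar>g w\<bar> / b\<close> with
    weights \<open>a / (a + b)\<close> and \<open>b / (a + b)\<close>.\<close>
  have pointwise: "\<bar>f w + g w\<bar> powr p \<le>
      (a + b) powr p * (a / (a + b) * (\<bar>f w\<bar> powr p / a powr p) + b / (a + b) * (\<bar>g w\<bar> powr p / b powr p))"
    if ab: "a > 0" "b > 0" for a b w
  proof -
    have "(a + b) * (a / (a + b) * (\<bar>f w\<bar> / a) + b / (a + b) * (\<bar>g w\<bar> / b)) = \<bar>f w\<bar> + \<bar>g w\<bar>"
      using ab by (simp add: distrib_left)
    then have "\<bar>f w + g w\<bar> powr p \<le> ((a + b) * (a / (a + b) * (\<bar>f w\<bar> / a) + b / (a + b) * (\<bar>g w\<bar> / b))) powr p"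
      using p by (intro powr_mono2) auto
    also have "\<dots> = (a + b) powr p * (a / (a + b) * (\<bar>f w\<bar> / a) + b / (a + b) * (\<bar>g w\<bar> / b)) powr p"
      by (rule powr_mult)
    also have "\<dots> \<le> (a + b) powr p *
        (a / (a + b) * (\<bar>f w\<bar> / a) powr p + b / (a + b) * (\<bar>g w\<bar> / b) powr p)"
      using ab p by (intro mult_left_mono convex_powr_nonneg) (auto simp: add_divide_distrib[symmetric])
    finally show ?thesis using ab by (simp add: powr_divide)
  qed
  show sum: "integrable M (\<lambda>w. \<bar>f w + g w\<bar> powr p)"
  proof (rule Bochner_Integration.integrable_bound)
    \<comment> \<open>The choice \<open>a = b = 1\<close> yields an integrable majorant.\<close>
    show "AE w in M. norm (\<bar>f w + g w\<bar> powr p) \<le>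
        norm ((1 + 1) powr p * (1 / (1 + 1) * (\<bar>f w\<bar> powr p / 1 powr p) + 1 / (1 + 1) * (\<bar>g w\<bar> powr p / 1 powr p)))"
      using pointwise[of 1 1] by (intro AE_I2) (auto intro: order_trans[OF _ abs_ge_self])
  qed (use int in auto)
  define A where "A = (LINT w|M. \<bar>f w\<bar> powr p) powr (1 / p)"
  define B where "B = (LINT w|M. \<bar>g w\<bar> powr p) powr (1 / p)"
  have AB: "A \<ge> 0" "B \<ge> 0" "(LINT w|M. \<bar>f w\<bar> powr p) = A powr p" "(LINT w|M. \<bar>g w\<bar> powr p) = B powr p"
    using p by (auto simp: A_def B_def powr_powr intro!: powr_one[symmetric])
  show "(LINT w|M. \<bar>f w + g w\<bar> powr p) powr (1 / p) \<le>
      (LINT w|M. \<bar>f w\<bar> powr p) powr (1 / p) + (LINT w|M. \<bar>g w\<bar> powr p) powr (1 / p)"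
    unfolding A_def[symmetric] B_def[symmetric]
  proof (rule field_le_epsilon)
    fix e :: real assume "e > 0"
    \<comment> \<open>Ideally \<open>a\<close> and \<open>b\<close> would be the two norms; adding
      \<open>e / 2\<close> keeps them positive when a norm is zero.\<close>
    define a b where "a = A + e / 2" and "b = B + e / 2"
    have ab: "a > 0" "b > 0" "a \<ge> A" "b \<ge> B" using AB \<open>e > 0\<close> by (auto simp: a_def b_def)
    have "(LINT w|M. \<bar>f w + g w\<bar> powr p) \<le> (LINT w|M. (a + b) powr p *
        (a / (a + b) * (\<bar>f w\<bar> powr p / a powr p) + b / (a + b) * (\<bar>g w\<bar> powr p / b powr p)))"
      using sum int pointwise[OF ab(1,2)] by (intro integral_mono) auto
    also have "\<dots> = (a + b) powr p * (a / (a + b) * (A powr p / a powr p) + b / (a + b) * (B powr p / b powr p))"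
      using int AB by simp
    also have "\<dots> \<le> (a + b) powr p * (a / (a + b) * 1 + b / (a + b) * 1)"
      using ab AB p by (intro mult_left_mono add_mono) (auto intro!: powr_mono2)
    also have "\<dots> = (a + b) powr p" using ab by (simp add: add_divide_distrib[symmetric])
    finally have "(LINT w|M. \<bar>f w + g w\<bar> powr p) powr (1 / p) \<le> ((a + b) powr p) powr (1 / p)"
      using p by (intro powr_mono2) auto
    also have "\<dots> = A + B + e" using ab p by (simp add: powr_powr a_def b_def)
    finally show "(LINT w|M. \<bar>f w + g w\<bar> powr p) powr (1 / p) \<le> A + B + e" .
  qed
qed

lemma simple_function_comp_integral:
  fixes \<phi> :: "'a \<Rightarrow> real"
  assumes "finite_measure M" and f: "simple_function M f"
  shows "integrable M (\<lambda>w. \<phi> (f w))"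
    and "(LINT w|M. \<phi> (f w)) = (\<Sum>v\<in>f ` space M. measure M (f -` {v} \<inter> space M) * \<phi> v)"
proof -
  interpret finite_measure M by fact
  have fin: "finite (f ` space M)" and sets: "\<And>v. f -` {v} \<inter> space M \<in> sets M"
    using simple_functionD[OF f] by auto
  have eq: "\<phi> (f w) = (\<Sum>v\<in>f ` space M. indicator (f -` {v} \<inter> space M) w * \<phi> v)" if "w \<in> space M" for w
  proof -
    have "(\<Sum>v\<in>f ` space M. indicator (f -` {v} \<inter> space M) w * \<phi> v) = (\<Sum>v\<in>f ` space M. if v = f w then \<phi> v else 0)"
      using that by (intro sum.cong) (auto simp: indicator_def)
    also have "\<dots> = \<phi> (f w)" using fin that by simp
    finally show ?thesis by simp
  qed
  have int: "integrable M (\<lambda>w. indicator (f -` {v} \<inter> space M) w * \<phi> v)" for v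
    using sets[of v] by (intro integrable_mult_left integrable_real_indicator) (auto simp: less_top[symmetric])
  have "integrable M (\<lambda>w. \<Sum>v\<in>f ` space M. indicator (f -` {v} \<inter> space M) w * \<phi> v)"
    by (intro Bochner_Integration.integrable_sum int)
  also have "?this \<longleftrightarrow> integrable M (\<lambda>w. \<phi> (f w))"
    using eq by (intro Bochner_Integration.integrable_cong) auto
  finally show "integrable M (\<lambda>w. \<phi> (f w))" .
  have "(LINT w|M. \<phi> (f w)) = (LINT w|M. (\<Sum>v\<in>f ` space M. indicator (f -` {v} \<inter> space M) w * \<phi> v))"
    using eq by (intro Bochner_Integration.integral_cong) auto
  also have "\<dots> = (\<Sum>v\<in>f ` space M. LINT w|M. indicator (f -` {v} \<inter> space M) w * \<phi> v)"
    by (intro Bochner_Integration.integral_sum int)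
  also have "\<dots> = (\<Sum>v\<in>f ` space M. measure M (f -` {v} \<inter> space M) * \<phi> v)"
    using sets by (intro sum.cong refl) (simp add: Int_absorb2)
  finally show "(LINT w|M. \<phi> (f w)) = (\<Sum>v\<in>f ` space M. measure M (f -` {v} \<inter> space M) * \<phi> v)" .
qed

text \<open>By disjointness at most one summand is nonzero at each point, so \<open>\<phi>\<close>,
  which vanishes at 0, passes through the sum.\<close>

lemma step_function_integral:
  fixes x :: "nat \<Rightarrow> 'a::real_vector" and \<phi> :: "'a \<Rightarrow> real"
  assumes "finite_measure M" and A: "\<And>i. i < n \<Longrightarrow> A i \<in> sets M"
    and disj: "disjoint_family_on A {..<n}" and "\<phi> 0 = 0"
  shows "simple_function M (\<lambda>w. \<Sum>i<n. indicator (A i) w *\<^sub>R x i)"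
    and "(LINT w|M. \<phi> (\<Sum>i<n. indicator (A i) w *\<^sub>R x i)) = (\<Sum>i<n. measure M (A i) * \<phi> (x i))"
proof -
  interpret finite_measure M by fact
  have "simple_function M (\<lambda>w. indicator (A i) w *\<^sub>R x i)" if "i < n" for i
    using simple_function_indicator[OF A[OF that]]
    by (rule simple_function_compose1[where g = "\<lambda>c. c *\<^sub>R x i"])
  then show "simple_function M (\<lambda>w. \<Sum>i<n. indicator (A i) w *\<^sub>R x i)" by (intro simple_function_sum) auto
  have eq: "\<phi> (\<Sum>i<n. indicator (A i) w *\<^sub>R x i) = (\<Sum>i<n. indicator (A i) w * \<phi> (x i))" for w
  proof (cases "\<exists>i<n. w \<in> A i")
    case True
    then obtain j where j: "j < n" "w \<in> A j" by blast
    then have "w \<notin> A i" if "i < n" "i \<noteq> j" for i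
      using disj that by (auto simp: disjoint_family_on_def)
    then have ind: "indicator (A i) w = (if i = j then 1 else 0 :: real)" if "i < n" for i
      using j that by auto
    have "(\<Sum>i<n. indicator (A i) w *\<^sub>R x i) = (\<Sum>i<n. if i = j then x i else 0)"
      by (intro sum.cong) (auto simp: ind)
    moreover have "(\<Sum>i<n. indicator (A i) w * \<phi> (x i)) = (\<Sum>i<n. if i = j then \<phi> (x i) else 0)"
      by (intro sum.cong) (auto simp: ind)
    ultimately show ?thesis using j by simp
  next
    case False
    with \<open>\<phi> 0 = 0\<close> show ?thesis by (simp add: indicator_def)
  qed
  show "(LINT w|M. \<phi> (\<Sum>i<n. indicator (A i) w *\<^sub>R x i)) = (\<Sum>i<n. measure M (A i) * \<phi> (x i))"
    unfolding eq using A sets.sets_into_space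
    by (subst Bochner_Integration.integral_sum)
      (auto simp: less_top[symmetric] Int_absorb2 intro!: sum.cong integrable_mult_left integrable_real_indicator)
qed

section \<open>Disjoint sets of positive measure\<close>

text \<open>Non-atomicity splits \<open>B\<close> into \<open>D\<close> and \<open>B - D\<close>,
  both of positive measure. The set \<open>D\<close> is kept and the induction continues inside
  \<open>B - D\<close>, which is why \<open>B\<close> varies.\<close>

lemma nonatomic_disjoint_sets:
  assumes "finite_measure M" and na: "nonatomic M"
    and "B \<in> sets M" "emeasure M B > 0"
  shows "\<exists>A. (\<forall>i<n. A i \<in> sets M \<and> A i \<subseteq> B \<and> measure M (A i) > 0) \<and> disjoint_family_on A {..<n::nat}"
  using assms(3,4)
proof (induction n arbitrary: B)
  case 0
  show ?case by (simp add: disjoint_family_on_def)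
next
  case (Suc n)
  interpret finite_measure M by fact
  obtain D where D: "D \<in> sets M" "D \<subseteq> B" "0 < emeasure M D" "emeasure M D < emeasure M B"
    using na Suc.prems by (auto simp: nonatomic_def)
  have "emeasure M (B - D) > 0"
    using D Suc.prems by (subst emeasure_Diff) (auto simp: diff_gt_0_iff_gt_ennreal)
  with Suc.IH[of "B - D"] D Suc.prems obtain A
    where A: "\<forall>i<n. A i \<in> sets M \<and> A i \<subseteq> B - D \<and> measure M (A i) > 0" "disjoint_family_on A {..<n}"
    by auto
  have "measure M D > 0" using D(3) by (simp add: emeasure_eq_measure)
  with A D have "\<forall>i<Suc n. (A(n := D)) i \<in> sets M \<and> (A(n := D)) i \<subseteq> B \<and> measure M ((A(n := D)) i) > 0"
    by (auto simp: less_Suc_eq)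
  moreover have "disjoint_family_on (A(n := D)) {..<Suc n}"
    using A unfolding lessThan_Suc disjoint_family_on_def by (simp add: less_Suc_eq) blast
  ultimately show ?case by blast
qed

subsection \<open>The norm of simple functions\<close>

text \<open>The integrand of \<open>Phi\<close>, which for \<open>p = 1 / (1 - \<sigma>)\<close> is
  also the summand in the definition of absolute continuity. A common name lets integrals and finite
  sums be compared.\<close>

definition sigma_weight :: "real \<Rightarrow> real \<Rightarrow> ('a::real_normed_vector \<Rightarrow>\<^sub>L real) \<Rightarrow> 'a \<Rightarrow> real" where
  "sigma_weight p \<sigma> x' v = (\<bar>x' v\<bar> powr (1 - \<sigma>) * norm v powr \<sigma>) powr p"

lemma sigma_weight_nonneg: "0 \<le> sigma_weight p \<sigma> x' v"
  by (simp add: sigma_weight_def)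

lemma sigma_weight_zero [simp]: "sigma_weight p \<sigma> x' 0 = 0" "sigma_weight p \<sigma> 0 v = 0"
  by (simp_all add: sigma_weight_def)

lemma sigma_weight_uminus [simp]: "sigma_weight p \<sigma> x' (- v) = sigma_weight p \<sigma> x' v"
  by (simp add: sigma_weight_def blinfun.minus_right)

text \<open>The exponents \<open>1 - \<sigma>\<close> and \<open>\<sigma>\<close> add up to 1, so
  the inner product is homogeneous of degree 1 and its power of degree \<open>p\<close>.\<close>

lemma sigma_weight_scaleR:
  assumes "0 \<le> c"
  shows "sigma_weight p \<sigma> x' (c *\<^sub>R v) = c powr p * sigma_weight p \<sigma> x' v"
proof -
  have "c powr (1 - \<sigma>) * c powr \<sigma> = c" using assms by (simp add: powr_add[symmetric])
  moreover have "(c * \<bar>x' v\<bar>) powr (1 - \<sigma>) * (c * norm v) powr \<sigma> =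
      (c powr (1 - \<sigma>) * c powr \<sigma>) * (\<bar>x' v\<bar> powr (1 - \<sigma>) * norm v powr \<sigma>)"
    by (simp add: powr_mult)
  ultimately have "(c * \<bar>x' v\<bar>) powr (1 - \<sigma>) * (c * norm v) powr \<sigma> =
      c * (\<bar>x' v\<bar> powr (1 - \<sigma>) * norm v powr \<sigma>)"
    by simp
  then show ?thesis
    unfolding sigma_weight_def using assms
    by (simp add: blinfun.scaleR_right abs_mult powr_mult[symmetric] del: mult_eq_0_iff)
qed

lemma sigma_weight_le:
  assumes "norm x' \<le> 1" "0 \<le> \<sigma>" "\<sigma> \<le> 1" "0 \<le> p"
  shows "sigma_weight p \<sigma> x' v \<le> norm v powr p"
proof -
  have "\<bar>x' v\<bar> \<le> norm v"
    using norm_blinfun[of x' v] mult_right_mono[OF assms(1), of "norm v"] by simp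
  then have "\<bar>x' v\<bar> powr (1 - \<sigma>) * norm v powr \<sigma> \<le> norm v powr (1 - \<sigma>) * norm v powr \<sigma>"
    using assms by (intro mult_right_mono powr_mono2) auto
  also have "\<dots> = norm v" by (simp add: powr_add[symmetric])
  finally show ?thesis unfolding sigma_weight_def using assms by (intro powr_mono2) auto
qed

lemma Phi_sigma_weight:
  "Phi p \<sigma> M f = (SUP x'\<in>cball 0 1. (LINT w|M. sigma_weight p \<sigma> x' (f w)) powr (1 / p))"
  by (simp add: Phi_def sigma_weight_def)

lemma Phi_uminus: "Phi p \<sigma> M (\<lambda>w. - f w) = Phi p \<sigma> M f"
  by (simp add: Phi_sigma_weight)

text \<open>The Bochner norm of \<open>f\<close> bounds all values. Boundedness is what allows
  single values to be estimated by the real supremum.\<close>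

lemma bdd_above_Phi:
  assumes "finite_measure M" "simple_function M f" "0 \<le> \<sigma>" "\<sigma> \<le> 1" "0 \<le> p"
  shows "bdd_above ((\<lambda>x'. (LINT w|M. sigma_weight p \<sigma> x' (f w)) powr (1 / p)) ` cball 0 1)"
proof (rule bdd_aboveI2)
  fix x' assume "x' \<in> cball (0 :: 'b \<Rightarrow>\<^sub>L real) 1"
  then show "(LINT w|M. sigma_weight p \<sigma> x' (f w)) powr (1 / p) \<le> (LINT w|M. norm (f w) powr p) powr (1 / p)"
    using assms
    by (intro powr_mono2 integral_mono simple_function_comp_integral(1)[OF assms(1,2)] sigma_weight_le
        Bochner_Integration.integral_nonneg sigma_weight_nonneg) auto
qed

text \<open>The functional 0 contributes the value 0 to the supremum.\<close>

lemma Phi_nonneg: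
  assumes "finite_measure M" "simple_function M f" "0 \<le> \<sigma>" "\<sigma> \<le> 1" "0 \<le> p"
  shows "0 \<le> Phi p \<sigma> M f"
  using cSUP_upper[OF _ bdd_above_Phi[OF assms], of 0] by (simp add: Phi_sigma_weight)

lemma Phi_scaleR_le:
  assumes "finite_measure M" "simple_function M f" "0 \<le> \<sigma>" "\<sigma> \<le> 1" "0 < p" "0 \<le> c"
  shows "Phi p \<sigma> M (\<lambda>w. c *\<^sub>R f w) \<le> c * Phi p \<sigma> M f"
  unfolding Phi_sigma_weight
proof (rule cSUP_least)
  fix x' assume "x' \<in> cball (0 :: 'b \<Rightarrow>\<^sub>L real) 1"
  then have "(LINT w|M. sigma_weight p \<sigma> x' (f w)) powr (1 / p) \<le>
      (SUP x'\<in>cball 0 1. (LINT w|M. sigma_weight p \<sigma> x' (f w)) powr (1 / p))"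
    using assms by (intro cSUP_upper bdd_above_Phi) auto
  then show "(LINT w|M. sigma_weight p \<sigma> x' (c *\<^sub>R f w)) powr (1 / p) \<le>
      c * (SUP x'\<in>cball 0 1. (LINT w|M. sigma_weight p \<sigma> x' (f w)) powr (1 / p))"
    using assms by (simp add: sigma_weight_scaleR powr_mult powr_powr mult_left_mono)
qed simp

section \<open>The norm as an infimum over decompositions\<close>

context
  fixes M :: "'w measure" and p \<sigma> :: real
  assumes fin: "finite_measure M" and \<sigma>: "0 \<le> \<sigma>" "\<sigma> \<le> 1" and p: "0 \<le> p"
begin

lemma simple_norm_set_nonempty:
  assumes "simple_function M f"
  shows "Phi p \<sigma> M f \<in> {\<Sum>i<n. Phi p \<sigma> M (g i) | (n::nat) g.
     (\<forall>i<n. simple_function M (g i)) \<and> (AE w in M. f w = (\<Sum>i<n. g i w))}"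
  using assms by (auto intro!: exI[of _ 1] exI[of _ "\<lambda>_. f"])

lemma simple_norm_le:
  fixes n :: nat
  assumes "\<forall>i<n. simple_function M (g i)" "AE w in M. f w = (\<Sum>i<n. g i w)"
  shows "simple_norm p \<sigma> M f \<le> (\<Sum>i<n. Phi p \<sigma> M (g i))"
  unfolding simple_norm_def
proof (rule cInf_lower)
  show "bdd_below {\<Sum>i<n. Phi p \<sigma> M (g i) | (n::nat) g.
     (\<forall>i<n. simple_function M (g i)) \<and> (AE w in M. f w = (\<Sum>i<n. g i w))}"
    by (rule bdd_belowI[of _ 0]) (auto intro!: sum_nonneg Phi_nonneg fin \<sigma> p)
  show "(\<Sum>i<n. Phi p \<sigma> M (g i)) \<in> {\<Sum>i<n. Phi p \<sigma> M (g i) | (n::nat) g.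
     (\<forall>i<n. simple_function M (g i)) \<and> (AE w in M. f w = (\<Sum>i<n. g i w))}"
    using assms by blast
qed

lemma le_simple_norm:
  assumes "simple_function M f"
    and "\<And>(n::nat) g. \<forall>i<n. simple_function M (g i) \<Longrightarrow> AE w in M. f w = (\<Sum>i<n. g i w) \<Longrightarrow>
      m \<le> (\<Sum>i<n. Phi p \<sigma> M (g i))"
  shows "m \<le> simple_norm p \<sigma> M f"
  unfolding simple_norm_def
proof (rule cInf_greatest)
  show "{\<Sum>i<n. Phi p \<sigma> M (g i) | (n::nat) g.
     (\<forall>i<n. simple_function M (g i)) \<and> (AE w in M. f w = (\<Sum>i<n. g i w))} \<noteq> {}"
    using simple_norm_set_nonempty[OF assms(1)] by blast
qed (use assms(2) in auto)

lemma simple_norm_le_Phi: "simple_function M f \<Longrightarrow> simple_norm p \<sigma> M f \<le> Phi p \<sigma> M f"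
  using simple_norm_le[of "Suc 0" "\<lambda>_. f" f] by (simp del: sum_constant)

lemma simple_norm_nonneg: "simple_function M f \<Longrightarrow> 0 \<le> simple_norm p \<sigma> M f"
  by (rule le_simple_norm) (auto intro!: sum_nonneg Phi_nonneg fin \<sigma> p)

text \<open>The empty decomposition gives the upper bound 0.\<close>

lemma simple_norm_zero: "simple_norm p \<sigma> M (\<lambda>w. 0) = 0"
  using simple_norm_le[of 0 _ "\<lambda>w. 0"] simple_norm_nonneg[of "\<lambda>w. 0"] by (auto intro: antisym)

lemma simple_norm_uminus_le:
  assumes f: "simple_function M f"
  shows "simple_norm p \<sigma> M (\<lambda>w. - f w) \<le> simple_norm p \<sigma> M f"
proof (rule le_simple_norm[OF f])
  fix n :: nat and g :: "nat \<Rightarrow> 'w \<Rightarrow> 'a"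
  assume g: "\<forall>i<n. simple_function M (g i)" "AE w in M. f w = (\<Sum>i<n. g i w)"
  have "simple_norm p \<sigma> M (\<lambda>w. - f w) \<le> (\<Sum>i<n. Phi p \<sigma> M (\<lambda>w. - g i w))"
    using g by (intro simple_norm_le) (auto simp: sum_negf intro: simple_function_compose1[where g = uminus])
  then show "simple_norm p \<sigma> M (\<lambda>w. - f w) \<le> (\<Sum>i<n. Phi p \<sigma> M (g i))" by (simp add: Phi_uminus)
qed

text \<open>Decompositions of \<open>f\<close> and \<open>f'\<close> are concatenated into one of
  the sum. The infima over the two are then taken one after the other.\<close>

lemma simple_norm_triangle:
  assumes f: "simple_function M f" and f': "simple_function M f'"
  shows "simple_norm p \<sigma> M (\<lambda>w. f w + f' w) \<le> simple_norm p \<sigma> M f + simple_norm p \<sigma> M f'"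
proof -
  let ?N = "simple_norm p \<sigma> M (\<lambda>w. f w + f' w)"
  have "?N - (\<Sum>j<n'. Phi p \<sigma> M (g' j)) \<le> simple_norm p \<sigma> M f"
    if g': "\<forall>j<n'. simple_function M (g' j)" "AE w in M. f' w = (\<Sum>j<n'. g' j w)" for n' :: nat and g'
  proof (rule le_simple_norm[OF f])
    fix n :: nat and g :: "nat \<Rightarrow> 'w \<Rightarrow> 'a"
    assume g: "\<forall>i<n. simple_function M (g i)" "AE w in M. f w = (\<Sum>i<n. g i w)"
    define h where "h i = (if i < n then g i else g' (i - n))" for i
    have h_w: "(\<Sum>i<n + n'. h i w) = (\<Sum>i<n. g i w) + (\<Sum>j<n'. g' j w)" for w
      by (induction n') (auto simp: h_def add.assoc)
    have h_Phi: "(\<Sum>i<n + n'. Phi p \<sigma> M (h i)) = (\<Sum>i<n. Phi p \<sigma> M (g i)) + (\<Sum>j<n'. Phi p \<sigma> M (g' j))"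
      by (induction n') (auto simp: h_def add.assoc)
    have "?N \<le> (\<Sum>i<n + n'. Phi p \<sigma> M (h i))"
    proof (rule simple_norm_le)
      show "\<forall>i<n + n'. simple_function M (h i)" using g g' by (auto simp: h_def)
      show "AE w in M. f w + f' w = (\<Sum>i<n + n'. h i w)"
        using g(2) g'(2) by eventually_elim (simp add: h_w)
    qed
    then show "?N - (\<Sum>j<n'. Phi p \<sigma> M (g' j)) \<le> (\<Sum>i<n. Phi p \<sigma> M (g i))"
      by (simp add: h_Phi)
  qed
  then have "?N - simple_norm p \<sigma> M f \<le> simple_norm p \<sigma> M f'"
    by (intro le_simple_norm[OF f']) (simp add: algebra_simps)
  then show ?thesis by simp
qed

lemma simple_norm_triangle_diff:
  assumes f: "simple_function M f" and f': "simple_function M f'"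
  shows "simple_norm p \<sigma> M (\<lambda>w. f w - f' w) \<le> simple_norm p \<sigma> M f + simple_norm p \<sigma> M f'"
proof -
  have "simple_function M (\<lambda>w. - f' w)" using f' by (rule simple_function_compose1)
  from simple_norm_triangle[OF f this] simple_norm_uminus_le[OF f'] show ?thesis by simp
qed

text \<open>The reverse triangle inequality, through which the norms along an approximating sequence
  form a Cauchy sequence of reals.\<close>

lemma simple_norm_diff_le:
  assumes f: "simple_function M f" and f': "simple_function M f'"
  shows "\<bar>simple_norm p \<sigma> M f - simple_norm p \<sigma> M f'\<bar> \<le> simple_norm p \<sigma> M (\<lambda>w. f w - f' w)"
proof -
  have d: "simple_function M (\<lambda>w. f w - f' w)" "simple_function M (\<lambda>w. f' w - f w)"
    using f f' by auto
  have "simple_norm p \<sigma> M f \<le> simple_norm p \<sigma> M (\<lambda>w. f w - f' w) + simple_norm p \<sigma> M f'"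
    using simple_norm_triangle[OF d(1) f'] by simp
  moreover have "simple_norm p \<sigma> M f' \<le> simple_norm p \<sigma> M (\<lambda>w. f' w - f w) + simple_norm p \<sigma> M f"
    using simple_norm_triangle[OF d(2) f] by simp
  moreover have "simple_norm p \<sigma> M (\<lambda>w. f' w - f w) \<le> simple_norm p \<sigma> M (\<lambda>w. f w - f' w)"
    using simple_norm_uminus_le[OF d(1)] by simp
  ultimately show ?thesis by simp
qed

lemma approximates_imp_convergent:
  assumes "approximates p \<sigma> M s f"
  shows "convergent (\<lambda>n. simple_norm p \<sigma> M (s n))"
proof (rule Cauchy_convergent, rule metric_CauchyI)
  fix e :: real assume "0 < e"
  with assms obtain N where "\<forall>m\<ge>N. \<forall>n\<ge>N. simple_norm p \<sigma> M (\<lambda>w. s m w - s n w) < e"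
    unfolding approximates_def by blast
  moreover have "dist (simple_norm p \<sigma> M (s m)) (simple_norm p \<sigma> M (s n)) \<le>
      simple_norm p \<sigma> M (\<lambda>w. s m w - s n w)" for m n
    using assms simple_norm_diff_le[of "s m" "s n"] by (simp add: approximates_def dist_real_def)
  ultimately show "\<exists>N. \<forall>m\<ge>N. \<forall>n\<ge>N. dist (simple_norm p \<sigma> M (s m)) (simple_norm p \<sigma> M (s n)) < e"
    by (meson le_less_trans)
qed

end

subsection \<open>Composition with simple functions\<close>

lemma powr_inverse_powr: "0 \<le> a \<Longrightarrow> 0 < p \<Longrightarrow> (a powr (1 / p)) powr p = (a::real)"
  "0 \<le> a \<Longrightarrow> 0 < p \<Longrightarrow> (a powr p) powr (1 / p) = a"
  by (simp_all add: powr_powr)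

lemma bochner_norm_nonneg: "0 \<le> bochner_norm p M f"
  by (simp add: bochner_norm_def)

lemma bochner_norm_powr: "0 < p \<Longrightarrow> bochner_norm p M f powr p = (LINT w|M. norm (f w) powr p)"
  unfolding bochner_norm_def by (intro powr_inverse_powr Bochner_Integration.integral_nonneg) auto

lemma bochner_norm_triangle_simple:
  assumes fin: "finite_measure M" and p: "1 \<le> p" and f: "simple_function M f" and g: "simple_function M g"
  shows "bochner_norm p M (\<lambda>w. f w + g w) \<le> bochner_norm p M f + bochner_norm p M g"
proof -
  note int = simple_function_comp_integral(1)[OF fin]
  have nf: "(\<lambda>w. norm (f w)) \<in> borel_measurable M" "(\<lambda>w. norm (g w)) \<in> borel_measurable M"
    using f g by (auto intro!: borel_measurable_simple_function intro: simple_function_compose1)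
  note mink = Minkowski_inequality[OF p nf]
  have ints: "integrable M (\<lambda>w. \<bar>norm (f w)\<bar> powr p)" "integrable M (\<lambda>w. \<bar>norm (g w)\<bar> powr p)"
    by (rule int[OF f] int[OF g])+
  have "(LINT w|M. norm (f w + g w) powr p) \<le> (LINT w|M. \<bar>norm (f w) + norm (g w)\<bar> powr p)"
    using p by (intro integral_mono powr_mono2 int[OF simple_function_add[OF f g]] mink(1)[OF ints])
      (auto intro: order_trans[OF norm_triangle_ineq])
  then have "bochner_norm p M (\<lambda>w. f w + g w) \<le> (LINT w|M. \<bar>norm (f w) + norm (g w)\<bar> powr p) powr (1 / p)"
    unfolding bochner_norm_def using p by (intro powr_mono2 Bochner_Integration.integral_nonneg) auto
  also have "\<dots> \<le> bochner_norm p M f + bochner_norm p M g"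
    using mink(2)[OF ints] by (simp add: bochner_norm_def)
  finally show ?thesis .
qed

lemma bochner_norm_sum_simple:
  fixes n :: nat
  assumes fin: "finite_measure M" and p: "1 \<le> p" and g: "\<forall>i<n. simple_function M (g i)"
  shows "bochner_norm p M (\<lambda>w. \<Sum>i<n. g i w) \<le> (\<Sum>i<n. bochner_norm p M (g i))"
  using g
proof (induction n)
  case 0
  then show ?case by (simp add: bochner_norm_def)
next
  case (Suc n)
  then have "bochner_norm p M (\<lambda>w. (\<Sum>i<n. g i w) + g n w) \<le>
      bochner_norm p M (\<lambda>w. \<Sum>i<n. g i w) + bochner_norm p M (g n)"
    by (intro bochner_norm_triangle_simple fin p simple_function_sum) auto
  with Suc show ?case by force
qed

text \<open>The Bochner norm is subadditive, so the bound by \<open>Phi\<close> on each summand adds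
  up over any decomposition of \<open>f\<close>, and the infimum preserves it. Decompositions hold
  only a.e., hence the comparison of integrals.\<close>

lemma bochner_norm_le_simple_norm:
  assumes fin: "finite_measure M" and \<sigma>: "0 \<le> \<sigma>" "\<sigma> \<le> 1" and p: "1 \<le> p"
    and u: "linear u" and "C > 0"
    and bound: "\<And>g. simple_function M g \<Longrightarrow> bochner_norm p M (\<lambda>w. u (g w)) \<le> C * Phi p \<sigma> M g"
    and f: "simple_function M f"
  shows "bochner_norm p M (\<lambda>w. u (f w)) \<le> C * simple_norm p \<sigma> M f"
proof -
  have "bochner_norm p M (\<lambda>w. u (f w)) / C \<le> simple_norm p \<sigma> M f"
  proof (rule le_simple_norm[OF fin \<sigma> _ f])
    fix n :: nat and g
    assume g: "\<forall>i<n. simple_function M (g i)" and eq: "AE w in M. f w = (\<Sum>i<n. g i w)"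
    have "bochner_norm p M (\<lambda>w. u (f w)) = bochner_norm p M (\<lambda>w. \<Sum>i<n. u (g i w))"
    proof -
      have "simple_function M (\<lambda>w. \<Sum>i<n. u (g i w))"
        using g by (intro simple_function_sum) (auto intro: simple_function_compose1)
      then have "(LINT w|M. norm (u (f w)) powr p) = (LINT w|M. norm (\<Sum>i<n. u (g i w)) powr p)"
        using simple_function_compose1[OF f, of "\<lambda>v. norm (u v) powr p"] eq
          simple_function_compose1[of M "\<lambda>w. \<Sum>i<n. u (g i w)" "\<lambda>v. norm v powr p"]
        by (intro integral_cong_AE borel_measurable_simple_function) (auto simp: linear_sum[OF u])
      then show ?thesis by (simp add: bochner_norm_def)
    qed
    also have "\<dots> \<le> (\<Sum>i<n. bochner_norm p M (\<lambda>w. u (g i w)))"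
      using g by (intro bochner_norm_sum_simple fin p) (auto intro: simple_function_compose1)
    also have "\<dots> \<le> (\<Sum>i<n. C * Phi p \<sigma> M (g i))"
      using g by (intro sum_mono bound) auto
    finally show "bochner_norm p M (\<lambda>w. u (f w)) / C \<le> (\<Sum>i<n. Phi p \<sigma> M (g i))"
      using \<open>C > 0\<close> by (simp add: sum_distrib_left[symmetric] field_simps)
  qed (use p in simp)
  then show ?thesis using \<open>C > 0\<close> by (simp add: field_simps)
qed

text \<open>The sum inequality with constant \<open>C\<close> is exactly the integral inequality for simple functions:
  the factors \<open>measure M A powr (1 / p)\<close> are absorbed into the vectors.\<close>

lemma bochner_norm_le_Phi:
  fixes u :: "'a::real_normed_vector \<Rightarrow> 'b::real_normed_vector"
  assumes fin: "finite_measure M" and p: "0 < p" and u: "linear u"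
    and ineq: "\<And>(n::nat) x. (\<Sum>i<n. norm (u (x i)) powr p) powr (1 / p)
      \<le> C * (SUP x'\<in>cball 0 1. (\<Sum>i<n. sigma_weight p \<sigma> x' (x i)) powr (1 / p))"
    and f: "simple_function M f"
  shows "bochner_norm p M (\<lambda>w. u (f w)) \<le> C * Phi p \<sigma> M f"
proof -
  have "finite (f ` space M)" using f by (rule simple_functionD)
  then obtain b n where b: "bij_betw b {..<n::nat} (f ` space M)"
    using ex_bij_betw_nat_finite by (metis atLeast0LessThan)
  \<comment> \<open>The map \<open>b\<close> enumerates the values of \<open>f\<close>. The factor
    is chosen so that a function homogeneous of degree \<open>p\<close> picks up exactly the measure
    of the level set.\<close>
  define x where "x i = measure M (f -` {b i} \<inter> space M) powr (1 / p) *\<^sub>R b i" for i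
  have sum: "(\<Sum>i<n. \<phi> (x i)) = (LINT w|M. \<phi> (f w))"
    if "\<And>c v. c \<ge> 0 \<Longrightarrow> \<phi> (c *\<^sub>R v) = c powr p * \<phi> v" for \<phi> :: "'a \<Rightarrow> real"
  proof -
    have "(\<Sum>i<n. \<phi> (x i)) = (\<Sum>i<n. measure M (f -` {b i} \<inter> space M) * \<phi> (b i))"
      using p by (simp add: x_def that powr_inverse_powr)
    also have "\<dots> = (\<Sum>v\<in>f ` space M. measure M (f -` {v} \<inter> space M) * \<phi> v)"
      using b by (rule sum.reindex_bij_betw)
    finally show ?thesis using simple_function_comp_integral(2)[OF fin f] by simp
  qed
  have "(\<Sum>i<n. norm (u (x i)) powr p) = (LINT w|M. norm (u (f w)) powr p)"
    by (rule sum) (simp add: linear_scale[OF u] powr_mult)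
  moreover have "(\<Sum>i<n. sigma_weight p \<sigma> x' (x i)) = (LINT w|M. sigma_weight p \<sigma> x' (f w))" for x'
    by (rule sum) (rule sigma_weight_scaleR)
  ultimately show ?thesis
    using ineq[of x n] by (simp add: bochner_norm_def Phi_sigma_weight)
qed

text \<open>The reverse passage from sums to integrals, and the place where non-atomicity enters:
  the vectors are spread over disjoint sets of positive measure, each scaled so that the measure of
  its set cancels.\<close>

lemma ex_simple_function_sums:
  fixes u :: "'a::real_normed_vector \<Rightarrow> 'b::real_normed_vector" and x :: "nat \<Rightarrow> 'a"
  assumes fin: "finite_measure M" and na: "nonatomic M" and pos: "emeasure M (space M) > 0"
    and p: "0 < p" and u: "linear u"
  obtains f where "simple_function M f"
    "bochner_norm p M (\<lambda>w. u (f w)) = (\<Sum>i<n. norm (u (x i)) powr p) powr (1 / p)"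
    "Phi p \<sigma> M f = (SUP x'\<in>cball 0 1. (\<Sum>i<n. sigma_weight p \<sigma> x' (x i)) powr (1 / p))"
proof -
  obtain A where A: "\<And>i. i < n \<Longrightarrow> A i \<in> sets M" "\<And>i. i < n \<Longrightarrow> measure M (A i) > 0"
      "disjoint_family_on A {..<n}"
    using nonatomic_disjoint_sets[OF fin na sets.top pos, of n] by blast
  define y where "y i = (1 / measure M (A i)) powr (1 / p) *\<^sub>R x i" for i
  define f where "f w = (\<Sum>i<n. indicator (A i) w *\<^sub>R y i)" for w
  note step = step_function_integral[OF fin A(1,3), of _ y, folded f_def]
  have int: "(LINT w|M. \<phi> (f w)) = (\<Sum>i<n. \<phi> (x i))"
    if scale: "\<And>c v. c \<ge> 0 \<Longrightarrow> \<phi> (c *\<^sub>R v) = c powr p * \<phi> v" for \<phi> :: "'a \<Rightarrow> real"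
  proof -
    have "\<phi> 0 = 0" using scale[of 0 0] by simp
    then have "(LINT w|M. \<phi> (f w)) = (\<Sum>i<n. measure M (A i) * \<phi> (y i))" by (intro step) auto
    also have "\<dots> = (\<Sum>i<n. \<phi> (x i))"
    proof (rule sum.cong[OF refl])
      fix i assume "i \<in> {..<n}"
      then have "measure M (A i) > 0" using A(2) by simp
      then show "measure M (A i) * \<phi> (y i) = \<phi> (x i)"
        using p by (simp add: y_def scale powr_inverse_powr(1) del: times_divide_eq_left)
    qed
    finally show ?thesis .
  qed
  show ?thesis
  proof (rule that[of f])
    show "simple_function M f" by (rule step(1)[of "\<lambda>_. 0"]) auto
    have "(LINT w|M. norm (u (f w)) powr p) = (\<Sum>i<n. norm (u (x i)) powr p)"
      by (rule int) (simp add: linear_scale[OF u] powr_mult)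
    then show "bochner_norm p M (\<lambda>w. u (f w)) = (\<Sum>i<n. norm (u (x i)) powr p) powr (1 / p)"
      by (simp add: bochner_norm_def)
    have "(LINT w|M. sigma_weight p \<sigma> x' (f w)) = (\<Sum>i<n. sigma_weight p \<sigma> x' (x i))" for x'
      by (rule int) (rule sigma_weight_scaleR)
    then show "Phi p \<sigma> M f = (SUP x'\<in>cball 0 1. (\<Sum>i<n. sigma_weight p \<sigma> x' (x i)) powr (1 / p))"
      by (simp add: Phi_sigma_weight)
  qed
qed

subsection \<open>Pettis limits\<close>

text \<open>The scalar part of membership in \<open>pettis_space\<close>: enough for Minkowski's
  inequality functional by functional, and closed under differences by that inequality
  alone.\<close>

definition weak_Lp :: "real \<Rightarrow> 'w measure \<Rightarrow> ('w \<Rightarrow> 'a::real_normed_vector) \<Rightarrow> bool" where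
  "weak_Lp p M f \<longleftrightarrow> (\<forall>x' :: 'a \<Rightarrow>\<^sub>L real.
     (\<lambda>w. x' (f w)) \<in> borel_measurable M \<and> integrable M (\<lambda>w. \<bar>x' (f w)\<bar> powr p))"

lemma weak_Lp_simple:
  assumes "finite_measure M" "simple_function M f"
  shows "weak_Lp p M f"
  unfolding weak_Lp_def
  by (intro allI conjI borel_measurable_simple_function simple_function_compose1[OF assms(2)]
      simple_function_comp_integral(1)[OF assms])

lemma weak_Lp_pettis_space: "f \<in> pettis_space p M \<Longrightarrow> weak_Lp p M f"
  by (auto simp: weak_Lp_def pettis_space_def pettis_integrable_def)

lemma weak_Lp_diff:
  fixes f g :: "'w \<Rightarrow> 'a::real_normed_vector"
  assumes "1 \<le> p" "weak_Lp p M f" "weak_Lp p M g"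
  shows "weak_Lp p M (\<lambda>w. f w - g w)"
  unfolding weak_Lp_def
proof (intro allI conjI)
  fix x' :: "'a \<Rightarrow>\<^sub>L real"
  show "(\<lambda>w. x' (f w - g w)) \<in> borel_measurable M"
    unfolding blinfun.diff_right using assms by (intro borel_measurable_diff) (auto simp: weak_Lp_def)
  show "integrable M (\<lambda>w. \<bar>x' (f w - g w)\<bar> powr p)"
    using assms Minkowski_inequality(1)[OF assms(1), of "\<lambda>w. x' (f w)" M "\<lambda>w. - x' (g w)"]
    by (simp add: weak_Lp_def blinfun.diff_right)
qed

lemma pettis_norm_triangle_diff:
  fixes f g :: "'w \<Rightarrow> 'a::real_normed_vector"
  assumes p: "1 \<le> p" and "weak_Lp p M f" "weak_Lp p M g"
  shows "pettis_norm p M (\<lambda>w. f w - g w) \<le> pettis_norm p M f + pettis_norm p M g"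
  unfolding pettis_norm_def[of p M "\<lambda>w. f w - g w"]
proof (rule SUP_least)
  fix x' :: "'a \<Rightarrow>\<^sub>L real" assume x': "x' \<in> cball 0 1"
  have "(LINT w|M. \<bar>x' (f w - g w)\<bar> powr p) powr (1 / p) \<le>
      (LINT w|M. \<bar>x' (f w)\<bar> powr p) powr (1 / p) + (LINT w|M. \<bar>x' (g w)\<bar> powr p) powr (1 / p)"
    using assms Minkowski_inequality(2)[OF p, of "\<lambda>w. x' (f w)" M "\<lambda>w. - x' (g w)"]
    by (simp add: weak_Lp_def blinfun.diff_right)
  then have "ennreal ((LINT w|M. \<bar>x' (f w - g w)\<bar> powr p) powr (1 / p)) \<le>
      ennreal ((LINT w|M. \<bar>x' (f w)\<bar> powr p) powr (1 / p)) + ennreal ((LINT w|M. \<bar>x' (g w)\<bar> powr p) powr (1 / p))"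
    by (simp add: ennreal_plus[symmetric] ennreal_leI del: ennreal_plus)
  also have "\<dots> \<le> pettis_norm p M f + pettis_norm p M g"
    unfolding pettis_norm_def using x' by (intro add_mono SUP_upper)
  finally show "ennreal ((LINT w|M. \<bar>x' (f w - g w)\<bar> powr p) powr (1 / p)) \<le>
      pettis_norm p M f + pettis_norm p M g" .
qed

lemma pettis_norm_zero: "pettis_norm p M (\<lambda>w. 0) = 0"
  by (simp add: pettis_norm_def)

text \<open>Ensures that the set of limits defining the norm of a difference is nonempty, so that
  its infimum can be exploited.\<close>

lemma approximates_diff:
  assumes fin: "finite_measure M" and \<sigma>: "0 \<le> \<sigma>" "\<sigma> \<le> 1" and p: "1 \<le> p"
    and f: "weak_Lp p M f" "approximates p \<sigma> M s f" and g: "weak_Lp p M g" "approximates p \<sigma> M t g"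
  shows "approximates p \<sigma> M (\<lambda>n w. s n w - t n w) (\<lambda>w. f w - g w)"
  unfolding approximates_def
proof (intro conjI allI impI)
  have s: "\<And>n. simple_function M (s n)" and t: "\<And>n. simple_function M (t n)"
    using f g by (auto simp: approximates_def)
  then show "simple_function M (\<lambda>w. s n w - t n w)" for n by auto
  show "\<exists>N. \<forall>m\<ge>N. \<forall>n\<ge>N. simple_norm p \<sigma> M (\<lambda>w. s m w - t m w - (s n w - t n w)) < e" if "e > 0" for e
  proof -
    have "e / 2 > 0" using that by simp
    then obtain N1 N2
      where N1: "\<And>m n. m \<ge> N1 \<Longrightarrow> n \<ge> N1 \<Longrightarrow> simple_norm p \<sigma> M (\<lambda>w. s m w - s n w) < e / 2"
        and N2: "\<And>m n. m \<ge> N2 \<Longrightarrow> n \<ge> N2 \<Longrightarrow> simple_norm p \<sigma> M (\<lambda>w. t m w - t n w) < e / 2"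
      using f(2) g(2) unfolding approximates_def by meson
    have "simple_norm p \<sigma> M (\<lambda>w. s m w - t m w - (s n w - t n w)) < e"
      if "m \<ge> max N1 N2" "n \<ge> max N1 N2" for m n
    proof -
      have "simple_norm p \<sigma> M (\<lambda>w. s m w - t m w - (s n w - t n w)) =
          simple_norm p \<sigma> M (\<lambda>w. (s m w - s n w) - (t m w - t n w))"
        by (simp add: algebra_simps)
      also have "\<dots> \<le> simple_norm p \<sigma> M (\<lambda>w. s m w - s n w) + simple_norm p \<sigma> M (\<lambda>w. t m w - t n w)"
        using s t p by (intro simple_norm_triangle_diff fin \<sigma>) auto
      also have "\<dots> < e" using N1[of m n] N2[of m n] that by simp
      finally show ?thesis .
    qed
    then show ?thesis by blast
  qed
  have le: "pettis_norm p M (\<lambda>w. s n w - t n w - (f w - g w)) \<le>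
      pettis_norm p M (\<lambda>w. s n w - f w) + pettis_norm p M (\<lambda>w. t n w - g w)" for n
  proof -
    have "pettis_norm p M (\<lambda>w. s n w - t n w - (f w - g w)) =
        pettis_norm p M (\<lambda>w. (s n w - f w) - (t n w - g w))"
      by (simp add: algebra_simps)
    also have "\<dots> \<le> pettis_norm p M (\<lambda>w. s n w - f w) + pettis_norm p M (\<lambda>w. t n w - g w)"
      by (intro pettis_norm_triangle_diff weak_Lp_diff weak_Lp_simple fin p s t f g)
    finally show ?thesis .
  qed
  have lim: "(\<lambda>n. pettis_norm p M (\<lambda>w. s n w - f w) + pettis_norm p M (\<lambda>w. t n w - g w)) \<longlonglongrightarrow> 0 + 0"
    using f(2) g(2) by (intro tendsto_add) (auto simp: approximates_def)
  show "(\<lambda>n. pettis_norm p M (\<lambda>w. s n w - t n w - (f w - g w))) \<longlonglongrightarrow> 0"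
  proof (rule tendsto_sandwich[OF _ always_eventually[OF allI[OF le]]])
    show "\<forall>\<^sub>F n in sequentially. 0 \<le> pettis_norm p M (\<lambda>w. s n w - t n w - (f w - g w))" by simp
  qed (use lim in simp_all)
qed

text \<open>The series of the \<open>d j\<close> has finite integral, hence converges a.e., and its
  terms tend to 0.\<close>

lemma AE_tendsto_zero_of_summable_integrals:
  fixes d :: "nat \<Rightarrow> 'w \<Rightarrow> real"
  assumes int: "\<And>j. integrable M (d j)" and nn: "\<And>j w. 0 \<le> d j w"
    and le: "\<And>j. (LINT w|M. d j w) \<le> c j" and c: "summable c"
  shows "AE w in M. (\<lambda>j. d j w) \<longlonglongrightarrow> 0"
proof -
  have [measurable]: "d j \<in> borel_measurable M" for j using int[of j] by simp
  have "(\<integral>\<^sup>+w. (\<Sum>j. ennreal (d j w)) \<partial>M) = (\<Sum>j. \<integral>\<^sup>+w. ennreal (d j w) \<partial>M)"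
    by (rule nn_integral_suminf) simp
  also have "\<dots> \<le> (\<Sum>j. ennreal (c j))"
    using int nn le by (intro suminf_le) (auto simp: nn_integral_eq_integral intro!: ennreal_leI)
  also have "\<dots> = ennreal (\<Sum>j. c j)"
    using order_trans[OF Bochner_Integration.integral_nonneg[OF nn] le] c by (rule suminf_ennreal2)
  finally have "AE w in M. (\<Sum>j. ennreal (d j w)) \<noteq> \<infinity>"
    by (intro nn_integral_PInf_AE) (auto simp: top_unique)
  then show ?thesis
  proof eventually_elim
    case (elim w)
    then have "summable (\<lambda>j. d j w)" using nn by (intro summable_suminf_not_top) auto
    then show ?case by (rule summable_LIMSEQ_zero)
  qed
qed

text \<open>Since the supremum over the dual ball is taken outside the integral, one subsequence
  serves all functionals.\<close>

lemma pettis_convergence_AE_subseq: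
  fixes h :: "'w \<Rightarrow> 'a::real_normed_vector"
  assumes p: "1 \<le> p" and weak: "\<And>n. weak_Lp p M (\<lambda>w. s n w - h w)"
    and lim: "(\<lambda>n. pettis_norm p M (\<lambda>w. s n w - h w)) \<longlonglongrightarrow> 0"
  obtains k :: "nat \<Rightarrow> nat" where "filterlim k at_top sequentially"
    "\<And>x' :: 'a \<Rightarrow>\<^sub>L real. AE w in M. (\<lambda>j. x' (s (k j) w)) \<longlonglongrightarrow> x' (h w)"
proof -
  have "\<exists>n\<ge>j. pettis_norm p M (\<lambda>w. s n w - h w) < ennreal ((1 / 2) ^ j)" for j :: nat
  proof -
    have "eventually (\<lambda>n. pettis_norm p M (\<lambda>w. s n w - h w) < ennreal ((1 / 2) ^ j)) sequentially"
      using lim by (rule order_tendstoD) simp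
    then show ?thesis unfolding eventually_sequentially by (meson nat_le_linear)
  qed
  \<comment> \<open>The bound \<open>j \<le> k j\<close> alone makes \<open>k\<close> tend to
    infinity; strict monotonicity is not asked for. The bounds \<open>(1 / 2) ^ j\<close> are
    summable.\<close>
  then obtain k where k: "\<And>j. k j \<ge> j" "\<And>j. pettis_norm p M (\<lambda>w. s (k j) w - h w) < ennreal ((1 / 2) ^ j)"
    by metis
  have ball: "AE w in M. (\<lambda>j. x' (s (k j) w)) \<longlonglongrightarrow> x' (h w)" if x': "norm x' \<le> 1" for x' :: "'a \<Rightarrow>\<^sub>L real"
  proof -
    have int: "(LINT w|M. \<bar>x' (s (k j) w - h w)\<bar> powr p) \<le> (1 / 2) ^ j" for j
    proof -
      let ?I = "LINT w|M. \<bar>x' (s (k j) w - h w)\<bar> powr p"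
      have "ennreal (?I powr (1 / p)) \<le> pettis_norm p M (\<lambda>w. s (k j) w - h w)"
        unfolding pettis_norm_def using x' by (intro SUP_upper) auto
      also have "\<dots> \<le> ennreal ((1 / 2) ^ j)" using k(2)[of j] by simp
      finally have "?I powr (1 / p) \<le> (1 / 2) ^ j" by simp
      then have "(?I powr (1 / p)) powr p \<le> ((1 / 2) ^ j) powr p"
        using p by (intro powr_mono2) auto
      \<comment> \<open>Raising a number in the unit interval to a power \<open>p \<ge> 1\<close>
        only decreases it, so the integrals stay summable.\<close>
      also have "\<dots> \<le> ((1 / 2) ^ j) powr 1"
        using p by (intro powr_mono') (auto simp: power_le_one)
      finally show ?thesis using p by (simp add: powr_inverse_powr(1))
    qed
    have "AE w in M. (\<lambda>j. \<bar>x' (s (k j) w - h w)\<bar> powr p) \<longlonglongrightarrow> 0"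
      using weak int by (intro AE_tendsto_zero_of_summable_integrals[where c = "\<lambda>j. (1 / 2) ^ j"])
        (auto simp: weak_Lp_def)
    then show ?thesis
    proof eventually_elim
      case (elim w)
      then have "(\<lambda>j. (\<bar>x' (s (k j) w - h w)\<bar> powr p) powr (1 / p)) \<longlonglongrightarrow> 0 powr (1 / p)"
        using p by (intro tendsto_powr') auto
      then have "(\<lambda>j. \<bar>x' (s (k j) w - h w)\<bar>) \<longlonglongrightarrow> 0"
        using p by (simp add: powr_inverse_powr)
      then have "(\<lambda>j. x' (s (k j) w) - x' (h w)) \<longlonglongrightarrow> 0"
        by (simp add: blinfun.diff_right tendsto_rabs_zero_iff)
      then show ?case by (simp add: LIM_zero_iff)
    qed
  qed
  show ?thesis
  proof (rule that[of k])
    show "filterlim k at_top sequentially"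
      using k(1) by (intro filterlim_at_top_mono[OF filterlim_ident]) auto
    fix x' :: "'a \<Rightarrow>\<^sub>L real"
    \<comment> \<open>A nonzero functional is scaled into the unit ball and back.\<close>
    show "AE w in M. (\<lambda>j. x' (s (k j) w)) \<longlonglongrightarrow> x' (h w)"
    proof (cases "x' = 0")
      case False
      have "AE w in M. (\<lambda>j. (x' /\<^sub>R norm x') (s (k j) w)) \<longlonglongrightarrow> (x' /\<^sub>R norm x') (h w)"
        using False by (intro ball) simp
      then show ?thesis
      proof eventually_elim
        case (elim w)
        then have "(\<lambda>j. norm x' * (x' /\<^sub>R norm x') (s (k j) w)) \<longlonglongrightarrow> norm x' * (x' /\<^sub>R norm x') (h w)"
          by (intro tendsto_mult tendsto_const)
        with False show ?case by (simp add: blinfun.scaleR_left)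
      qed
    qed simp
  qed
qed

text \<open>Weak convergence only gives lower semicontinuity of the norm, hence Fatou's lemma. The
  exceptional null set is controlled by norming the countably many values of the \<open>t n\<close>.\<close>

lemma nn_integral_norm_le_of_pettis_limit:
  fixes h :: "'w \<Rightarrow> 'a::real_normed_vector" and u :: "'a \<Rightarrow> 'b::real_normed_vector"
  assumes fin: "finite_measure M" and p: "1 \<le> p" and u: "bounded_linear u"
    and t: "\<And>n. simple_function M (t n)" "AE w in M. (\<lambda>n. t n w) \<longlonglongrightarrow> h w"
    and s: "\<And>n. simple_function M (s n)"
    and weak: "weak_Lp p M h" and lim: "(\<lambda>n. pettis_norm p M (\<lambda>w. s n w - h w)) \<longlonglongrightarrow> 0"
    and bound: "\<And>n. bochner_norm p M (\<lambda>w. u (s n w)) \<le> B n" and B: "B \<longlonglongrightarrow> L"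
  shows "(\<integral>\<^sup>+w. ennreal (norm (u (h w)) powr p) \<partial>M) \<le> ennreal (L powr p)"
proof -
  interpret u: bounded_linear u by fact
  obtain k where k: "filterlim k at_top sequentially"
      "\<And>x' :: 'a \<Rightarrow>\<^sub>L real. AE w in M. (\<lambda>j. x' (s (k j) w)) \<longlonglongrightarrow> x' (h w)"
    using pettis_convergence_AE_subseq[OF p weak_Lp_diff[OF p weak_Lp_simple[OF fin s] weak] lim] by blast
  \<comment> \<open>A countable set of which \<open>h w\<close> is a limit point or an element for
    a.e. \<open>w\<close>; only functionals norming \<open>u d\<close> for \<open>d\<close> in
    \<open>D\<close> are used.\<close>
  define D where "D = (\<Union>n. t n ` space M)"
  have "countable D" unfolding D_def using simple_functionD(1)[OF t(1)] by (auto intro: countable_finite)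
  have "\<forall>d. \<exists>y' :: 'b \<Rightarrow>\<^sub>L real. norm y' \<le> 1 \<and> blinfun_apply y' (u d) = norm (u d)"
    using ex_norming_functional by metis
  then obtain y' :: "'a \<Rightarrow> 'b \<Rightarrow>\<^sub>L real" where y': "\<And>d. norm (y' d) \<le> 1" "\<And>d. blinfun_apply (y' d) (u d) = norm (u d)"
    by metis
  have y'_le: "\<bar>y' d v\<bar> \<le> norm v" for d v
    using norm_blinfun[of "y' d" v] mult_right_mono[OF y'(1)[of d], of "norm v"] by simp
  have "AE w in M. \<forall>d\<in>D. (\<lambda>j. y' d (u (s (k j) w))) \<longlonglongrightarrow> y' d (u (h w))"
  proof (rule AE_ball_countable[THEN iffD2, OF \<open>countable D\<close>], rule ballI)
    fix d
    show "AE w in M. (\<lambda>j. y' d (u (s (k j) w))) \<longlonglongrightarrow> y' d (u (h w))"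
      using k(2)[of "y' d o\<^sub>L Blinfun u"] by (simp add: bounded_linear_Blinfun_apply[OF u])
  qed
  with t(2) AE_space have "AE w in M. ennreal (norm (u (h w)) powr p) \<le>
      liminf (\<lambda>j. ennreal (norm (u (s (k j) w)) powr p))"
  proof eventually_elim
    case (elim w)
    have lower: "eventually (\<lambda>j. a < norm (u (s (k j) w))) sequentially" if a: "a < norm (u (h w))" for a
    proof -
      \<comment> \<open>Half the gap, since two errors occur: replacing \<open>u (h w)\<close> by
        \<open>u (t n w)\<close> in the norm, and replacing it back inside the functional that norms
        \<open>u (t n w)\<close>.\<close>
      define e where "e = (norm (u (h w)) - a) / 2"
      have "e > 0" using a by (simp add: e_def)
      have "(\<lambda>n. u (h w - t n w)) \<longlonglongrightarrow> u (h w - h w)"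
        using elim(1) by (intro u.tendsto tendsto_diff tendsto_const)
      then have "eventually (\<lambda>n. norm (u (h w - t n w)) < e) sequentially"
        using \<open>e > 0\<close> by (auto simp: u.zero tendsto_iff)
      then obtain n where n: "norm (u (h w - t n w)) < e" by (auto dest: eventually_happens)
      let ?d = "t n w"
      have "norm (u (h w)) \<le> norm (u ?d) + norm (u (h w - ?d))"
        using norm_triangle_ineq[of "u ?d" "u (h w - ?d)"] by (simp add: u.diff)
      moreover have "norm (u ?d) = y' ?d (u (h w)) - y' ?d (u (h w - ?d))"
        by (simp add: u.diff blinfun.diff_right y')
      ultimately have "a < y' ?d (u (h w))"
        using n y'_le[of ?d "u (h w - ?d)"] by (simp add: e_def field_simps)
      moreover have "?d \<in> D" using elim(2) by (auto simp: D_def)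
      ultimately have "eventually (\<lambda>j. a < y' ?d (u (s (k j) w))) sequentially"
        using elim(3) by (intro order_tendstoD(1)) auto
      then show ?thesis
        by eventually_elim (use y'_le in \<open>smt (verit)\<close>)
    qed
    \<comment> \<open>Truncation at the limit value turns the one-sided estimate into convergence,
      to which continuity of the power applies.\<close>
    have "(\<lambda>j. min (norm (u (s (k j) w))) (norm (u (h w)))) \<longlonglongrightarrow> norm (u (h w))"
      by (rule order_tendstoI) (auto simp: lower min_less_iff_disj)
    then have "(\<lambda>j. ennreal (min (norm (u (s (k j) w))) (norm (u (h w))) powr p)) \<longlonglongrightarrow>
        ennreal (norm (u (h w)) powr p)"
      using p by (intro tendsto_ennrealI tendsto_powr') auto
    then have "ennreal (norm (u (h w)) powr p) =
        liminf (\<lambda>j. ennreal (min (norm (u (s (k j) w))) (norm (u (h w))) powr p))"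
      by (intro lim_imp_Liminf[symmetric] sequentially_bot)
    also have "\<dots> \<le> liminf (\<lambda>j. ennreal (norm (u (s (k j) w)) powr p))"
      using p by (intro Liminf_mono always_eventually allI ennreal_leI powr_mono2) auto
    finally show ?case .
  qed
  then have "(\<integral>\<^sup>+w. ennreal (norm (u (h w)) powr p) \<partial>M) \<le>
      (\<integral>\<^sup>+w. liminf (\<lambda>j. ennreal (norm (u (s (k j) w)) powr p)) \<partial>M)"
    by (rule nn_integral_mono_AE)
  also have "\<dots> \<le> liminf (\<lambda>j. \<integral>\<^sup>+w. ennreal (norm (u (s (k j) w)) powr p) \<partial>M)"
  proof (rule nn_integral_liminf)
    fix j
    show "(\<lambda>w. ennreal (norm (u (s (k j) w)) powr p)) \<in> borel_measurable M"
      by (intro borel_measurable_simple_function simple_function_compose1[OF s])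
  qed
  also have "\<dots> \<le> liminf (\<lambda>j. ennreal (B (k j) powr p))"
  proof (intro Liminf_mono always_eventually allI)
    fix j
    have "(\<integral>\<^sup>+w. ennreal (norm (u (s (k j) w)) powr p) \<partial>M) = ennreal (LINT w|M. norm (u (s (k j) w)) powr p)"
      by (intro nn_integral_eq_integral simple_function_comp_integral(1)[OF fin s]) simp
    also have "\<dots> = ennreal (bochner_norm p M (\<lambda>w. u (s (k j) w)) powr p)"
      using p by (simp add: bochner_norm_powr)
    also have "\<dots> \<le> ennreal (B (k j) powr p)"
      using p by (intro ennreal_leI powr_mono2 bochner_norm_nonneg bound) auto
    finally show "(\<integral>\<^sup>+w. ennreal (norm (u (s (k j) w)) powr p) \<partial>M) \<le> ennreal (B (k j) powr p)" .
  qed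
  also have "\<dots> = ennreal (L powr p)"
  proof (rule lim_imp_Liminf)
    have "B n \<ge> 0" for n using bochner_norm_nonneg bound by (rule order_trans)
    then show "(\<lambda>j. ennreal (B (k j) powr p)) \<longlonglongrightarrow> ennreal (L powr p)"
      using p filterlim_compose[OF B k(1)] by (intro tendsto_ennrealI tendsto_powr') auto
  qed simp
  finally show ?thesis .
qed

section \<open>Simple functions as elements of the function spaces\<close>

lemma simple_in_pettis_space:
  fixes f :: "'w \<Rightarrow> 'a::real_normed_vector"
  assumes fin: "finite_measure M" and f: "simple_function M f"
  shows "f \<in> pettis_space p M"
proof -
  note int = simple_function_comp_integral(1)[OF fin f]
  have strong: "strongly_measurable M f"
    unfolding strongly_measurable_def using f borel_measurable_simple_function[OF f]
    by (intro conjI exI[of _ "\<lambda>_. f"]) auto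
  have pettis: "pettis_integrable M f"
    unfolding pettis_integrable_def
  proof (intro conjI allI ballI)
    show "integrable M (\<lambda>w. x' (f w))" for x' :: "'a \<Rightarrow>\<^sub>L real" by (rule int)
    fix A assume A: "A \<in> sets M"
    let ?f = "\<lambda>w. indicator A w *\<^sub>R f w"
    have sf: "simple_function M ?f"
      using simple_function_compose2[OF simple_function_indicator[OF A] f, of "(*\<^sub>R)"] .
    \<comment> \<open>The witness is the integral of \<open>f\<close> over \<open>A\<close>, written
      as a finite sum over the level sets of the restricted function.\<close>
    have "x' (\<Sum>v\<in>?f ` space M. measure M (?f -` {v} \<inter> space M) *\<^sub>R v) = (LINT w:A|M. x' (f w))"
      for x' :: "'a \<Rightarrow>\<^sub>L real"
      using simple_function_comp_integral(2)[OF fin sf, of "blinfun_apply x'"]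
      by (simp add: set_lebesgue_integral_def blinfun.sum_right blinfun.scaleR_right)
    then show "\<exists>x. \<forall>x' :: 'a \<Rightarrow>\<^sub>L real. x' x = (LINT w:A|M. x' (f w))" by blast
  qed
  show ?thesis unfolding pettis_space_def by (intro CollectI conjI allI strong pettis int)
qed

lemma approximates_simple:
  assumes "finite_measure M" "0 \<le> \<sigma>" "\<sigma> \<le> 1" "0 \<le> p" and f: "simple_function M f"
  shows "approximates p \<sigma> M (\<lambda>_. f) f"
  using f by (auto simp: approximates_def pettis_norm_zero simple_norm_zero[OF assms(1-4)])

lemma simple_in_pettis_sigma_space:
  assumes "finite_measure M" "0 \<le> \<sigma>" "\<sigma> \<le> 1" "0 \<le> p" "simple_function M f"
  shows "f \<in> pettis_sigma_space p \<sigma> M"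
  using approximates_simple[OF assms] simple_in_pettis_space[OF assms(1,5)]
  by (auto simp: pettis_sigma_space_def)

text \<open>The constant sequence \<open>f\<close> competes in the infimum over approximating
  sequences, and the one-term decomposition in the infimum over decompositions.\<close>

lemma pettis_sigma_norm_le_Phi:
  assumes fin: "finite_measure M" and \<sigma>: "0 \<le> \<sigma>" "\<sigma> \<le> 1" and p: "0 \<le> p" and f: "simple_function M f"
  shows "pettis_sigma_norm p \<sigma> M f \<le> Phi p \<sigma> M f"
proof -
  have "pettis_sigma_norm p \<sigma> M f \<le> simple_norm p \<sigma> M f"
    unfolding pettis_sigma_norm_def
  proof (rule cInf_lower)
    show "bdd_below {L. \<exists>s. approximates p \<sigma> M s f \<and> (\<lambda>n. simple_norm p \<sigma> M (s n)) \<longlonglongrightarrow> L}"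
      by (rule bdd_belowI[of _ 0])
        (auto simp: approximates_def intro!: LIMSEQ_le_const simple_norm_nonneg[OF fin \<sigma> p])
  qed (use approximates_simple[OF assms] in \<open>auto intro!: exI[of _ "\<lambda>_. f"]\<close>)
  with simple_norm_le_Phi[OF fin \<sigma> p f] show ?thesis by simp
qed

subsection \<open>Continuity of the composition operator\<close>

lemma absolutely_continuous_op_1_iff:
  assumes "p = 1 / (1 - \<sigma>)"
  shows "absolutely_continuous_op 1 \<sigma> T \<longleftrightarrow> linear T \<and>
    (\<exists>C>0. \<forall>(n::nat) x. (\<Sum>i<n. norm (T (x i)) powr p) powr (1 / p)
      \<le> C * (SUP x'\<in>cball 0 1. (\<Sum>i<n. sigma_weight p \<sigma> x' (x i)) powr (1 / p)))"
  by (simp add: absolutely_continuous_op_def sigma_weight_def assms)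

text \<open>Phrased with the nonnegative integral, so that it yields integrability of the
  composition as well as the bound for its norm.\<close>

lemma composition_bounded:
  fixes u :: "'a::real_normed_vector \<Rightarrow> 'b::real_normed_vector"
  assumes fin: "finite_measure M" and \<sigma>: "0 \<le> \<sigma>" "\<sigma> \<le> 1" and p: "1 \<le> p"
    and u: "bounded_linear u" and C: "C > 0"
    and bound: "\<And>g. simple_function M g \<Longrightarrow> bochner_norm p M (\<lambda>w. u (g w)) \<le> C * Phi p \<sigma> M g"
    and t: "\<And>n. simple_function M (t n)" "AE w in M. (\<lambda>n. t n w) \<longlonglongrightarrow> h w"
    and weak: "weak_Lp p M h" and s: "approximates p \<sigma> M s h"
    and L: "(\<lambda>n. simple_norm p \<sigma> M (s n)) \<longlonglongrightarrow> L"
  shows "(\<integral>\<^sup>+w. ennreal (norm (u (h w)) powr p) \<partial>M) \<le> ennreal ((C * L) powr p)"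
proof (rule nn_integral_norm_le_of_pettis_limit[OF fin p u t _ weak])
  show simple: "simple_function M (s n)" for n using s by (simp add: approximates_def)
  show "(\<lambda>n. pettis_norm p M (\<lambda>w. s n w - h w)) \<longlonglongrightarrow> 0" using s by (simp add: approximates_def)
  show "bochner_norm p M (\<lambda>w. u (s n w)) \<le> C * simple_norm p \<sigma> M (s n)" for n
    by (intro bochner_norm_le_simple_norm fin \<sigma> p bounded_linear.linear[OF u] C bound simple)
  show "(\<lambda>n. C * simple_norm p \<sigma> M (s n)) \<longlonglongrightarrow> C * L" using L by (rule tendsto_mult_left)
qed

context
  fixes M :: "'w measure" and u :: "'a::real_normed_vector \<Rightarrow> 'b::real_normed_vector" and p \<sigma> C :: real
  assumes fin: "finite_measure M" and \<sigma>: "0 \<le> \<sigma>" "\<sigma> \<le> 1" and p: "1 \<le> p"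
    and u: "bounded_linear u" and C: "C > 0"
    and bound: "\<And>g. simple_function M g \<Longrightarrow> bochner_norm p M (\<lambda>w. u (g w)) \<le> C * Phi p \<sigma> M g"
begin

lemma composition_well_defined:
  assumes f: "f \<in> pettis_sigma_space p \<sigma> M"
  shows "u \<circ> f \<in> bochner_space p M"
proof -
  obtain s where s: "approximates p \<sigma> M s f" using f by (auto simp: pettis_sigma_space_def)
  then obtain L where L: "(\<lambda>n. simple_norm p \<sigma> M (s n)) \<longlonglongrightarrow> L"
    using approximates_imp_convergent[OF fin \<sigma>, of p s f] p by (auto simp: convergent_def)
  have fp: "f \<in> pettis_space p M" using f by (simp add: pettis_sigma_space_def)
  then have "strongly_measurable M f" by (simp add: pettis_space_def)
  then obtain t where meas: "f \<in> borel_measurable M"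
    and t: "\<And>n. simple_function M (t n)" "AE w in M. (\<lambda>n. t n w) \<longlonglongrightarrow> f w"
    unfolding strongly_measurable_def by blast
  have cont: "continuous_on UNIV u" using u by (intro linear_continuous_on)
  have uf: "u \<circ> f \<in> borel_measurable M"
    using meas borel_measurable_continuous_onI[OF cont] by (rule measurable_comp)
  have "strongly_measurable M (u \<circ> f)"
    unfolding strongly_measurable_def
  proof (intro conjI exI[of _ "\<lambda>n w. u (t n w)"] allI uf simple_function_compose1[OF t(1)])
    from t(2) show "AE w in M. (\<lambda>n. u (t n w)) \<longlonglongrightarrow> (u \<circ> f) w"
      by eventually_elim (auto intro: bounded_linear.tendsto[OF u])
  qed
  moreover have "integrable M (\<lambda>w. norm ((u \<circ> f) w) powr p)"
  proof (rule integrableI_bounded)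
    have "(\<lambda>w. norm ((u \<circ> f) w)) \<in> borel_measurable M"
      using uf by (rule measurable_compose) (intro borel_measurable_continuous_onI continuous_intros)
    then show "(\<lambda>w. norm ((u \<circ> f) w) powr p) \<in> borel_measurable M" by measurable
    have "(\<integral>\<^sup>+w. ennreal (norm (u (f w)) powr p) \<partial>M) \<le> ennreal ((C * L) powr p)"
      by (rule composition_bounded[OF fin \<sigma> p u C bound t weak_Lp_pettis_space[OF fp] s L])
    then show "(\<integral>\<^sup>+w. ennreal (norm (norm ((u \<circ> f) w) powr p)) \<partial>M) < \<infinity>"
      by (simp add: le_less_trans)
  qed
  ultimately show ?thesis by (simp add: bochner_space_def)
qed

lemma composition_continuous:
  "norm_continuous_on (pettis_sigma_space p \<sigma> M) (pettis_sigma_norm p \<sigma> M) (bochner_norm p M) (\<lambda>f. u \<circ> f)"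
  unfolding norm_continuous_on_def
proof (intro ballI allI impI)
  fix f :: "'w \<Rightarrow> 'a" and e :: real
  assume f: "f \<in> pettis_sigma_space p \<sigma> M" and e: "e > 0"
  show "\<exists>d>0. \<forall>g\<in>pettis_sigma_space p \<sigma> M. pettis_sigma_norm p \<sigma> M (\<lambda>w. g w - f w) < d \<longrightarrow>
      bochner_norm p M (\<lambda>w. (u \<circ> g) w - (u \<circ> f) w) < e"
  proof (intro exI[of _ "e / C"] conjI ballI impI)
    show "e / C > 0" using e C by simp
    fix g :: "'w \<Rightarrow> 'a"
    assume g: "g \<in> pettis_sigma_space p \<sigma> M"
      and less: "pettis_sigma_norm p \<sigma> M (\<lambda>w. g w - f w) < e / C"
    let ?h = "\<lambda>w. g w - f w"
    obtain s r where sr: "approximates p \<sigma> M s f" "approximates p \<sigma> M r g"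
      using f g by (auto simp: pettis_sigma_space_def)
    have fg: "f \<in> pettis_space p M" "g \<in> pettis_space p M"
      using f g by (auto simp: pettis_sigma_space_def)
    note weak = this[THEN weak_Lp_pettis_space]
    let ?S = "{L. \<exists>s. approximates p \<sigma> M s ?h \<and> (\<lambda>n. simple_norm p \<sigma> M (s n)) \<longlonglongrightarrow> L}"
    have "approximates p \<sigma> M (\<lambda>n w. r n w - s n w) ?h"
      by (intro approximates_diff fin \<sigma> p weak sr)
    then have "?S \<noteq> {}"
      using approximates_imp_convergent[OF fin \<sigma>, of p "\<lambda>n w. r n w - s n w" ?h] p by (auto simp: convergent_def)
    \<comment> \<open>An infimum below \<open>e / C\<close> provides an approximating sequence for
      the difference whose norms have a limit \<open>L\<close> below \<open>e / C\<close>.\<close>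
    from cInf_lessD[OF this less[unfolded pettis_sigma_norm_def]]
    obtain L q where q: "approximates p \<sigma> M q ?h" "(\<lambda>n. simple_norm p \<sigma> M (q n)) \<longlonglongrightarrow> L" "L < e / C"
      by blast
    have "0 \<le> L"
      using q(1) p by (intro LIMSEQ_le_const[OF q(2)]) (auto simp: approximates_def intro!: simple_norm_nonneg[OF fin \<sigma>])
    obtain t t' where t: "\<And>n. simple_function M (t n)" "AE w in M. (\<lambda>n. t n w) \<longlonglongrightarrow> f w"
      and t': "\<And>n. simple_function M (t' n)" "AE w in M. (\<lambda>n. t' n w) \<longlonglongrightarrow> g w"
      using fg unfolding pettis_space_def strongly_measurable_def by blast
    have "simple_function M (\<lambda>w. t' n w - t n w)" for n using t t' by auto
    moreover have "AE w in M. (\<lambda>n. t' n w - t n w) \<longlonglongrightarrow> ?h w"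
      using t(2) t'(2) by eventually_elim (rule tendsto_diff)
    ultimately have nn: "(\<integral>\<^sup>+w. ennreal (norm (u (?h w)) powr p) \<partial>M) \<le> ennreal ((C * L) powr p)"
      using q(1,2)
      by (intro composition_bounded[where t = "\<lambda>n w. t' n w - t n w" and s = q,
            OF fin \<sigma> p u C bound _ _ weak_Lp_diff[OF p weak(2,1)]])
    have "(LINT w|M. norm (u (?h w)) powr p) \<le> (C * L) powr p"
    \<comment> \<open>The Bochner norm uses the real integral, which is 0 by convention for a
      non-integrable function; the bound holds in that case as well.\<close>
    proof (cases "integrable M (\<lambda>w. norm (u (?h w)) powr p)")
      case True
      with nn show ?thesis by (simp add: nn_integral_eq_integral)
    qed (simp add: not_integrable_integral_eq)
    then have "bochner_norm p M (\<lambda>w. u (?h w)) \<le> ((C * L) powr p) powr (1 / p)"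
      unfolding bochner_norm_def using p by (intro powr_mono2 Bochner_Integration.integral_nonneg) auto
    also have "\<dots> = C * L" using p C \<open>0 \<le> L\<close> by (intro powr_inverse_powr) auto
    also have "\<dots> < e" using q(3) C by (simp add: field_simps)
    finally show "bochner_norm p M (\<lambda>w. (u \<circ> g) w - (u \<circ> f) w) < e"
      using bounded_linear.linear[OF u] by (simp add: linear_diff)
  qed
qed

end

section \<open>From continuity back to an inequality for simple functions\<close>

lemma bochner_norm_le_Phi_of_continuous:
  fixes M :: "'w measure" and u :: "'a::real_normed_vector \<Rightarrow> 'b::real_normed_vector"
  assumes fin: "finite_measure M" and \<sigma>: "0 \<le> \<sigma>" "\<sigma> \<le> 1" and p: "1 \<le> p" and u: "linear u"
    and cont: "norm_continuous_on (pettis_sigma_space p \<sigma> M) (pettis_sigma_norm p \<sigma> M) (bochner_norm p M) (\<lambda>f. u \<circ> f)"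
  obtains C where "C > 0" "\<And>f :: 'w \<Rightarrow> 'a. simple_function M f \<Longrightarrow> bochner_norm p M (\<lambda>w. u (f w)) \<le> C * Phi p \<sigma> M f"
proof -
  have p0: "0 \<le> p" using p by simp
  have "(\<lambda>w. 0) \<in> pettis_sigma_space p \<sigma> M"
    by (intro simple_in_pettis_sigma_space fin \<sigma> p0) simp
  \<comment> \<open>Continuity at the zero function with tolerance 1; the constant will be
    \<open>1 / d\<close>.\<close>
  then obtain d where d: "d > 0" "\<And>g. g \<in> pettis_sigma_space p \<sigma> M \<Longrightarrow>
      pettis_sigma_norm p \<sigma> M g < d \<Longrightarrow> bochner_norm p M (\<lambda>w. u (g w)) < 1"
    using cont[unfolded norm_continuous_on_def, rule_format, of "\<lambda>w. 0" 1] linear_0[OF u] by auto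
  have small: "bochner_norm p M (\<lambda>w. u (g w)) < 1" if g: "simple_function M g" "Phi p \<sigma> M g < d" for g :: "'w \<Rightarrow> 'a"
    using pettis_sigma_norm_le_Phi[OF fin \<sigma> p0 g(1)] g
    by (intro d(2) simple_in_pettis_sigma_space fin \<sigma> p0) auto
  show ?thesis
  proof (rule that[of "1 / d"])
    show "1 / d > 0" using d by simp
    fix f :: "'w \<Rightarrow> 'a" assume f: "simple_function M f"
    let ?R = "bochner_norm p M (\<lambda>w. u (f w))" and ?S = "Phi p \<sigma> M f"
    show "?R \<le> 1 / d * ?S"
    proof (rule ccontr)
      assume "\<not> ?R \<le> 1 / d * ?S"
      then have less: "?S < d * ?R" using d(1) by (simp add: field_simps)
      have S: "0 \<le> ?S" using Phi_nonneg[OF fin f \<sigma> p0] .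
      then have R: "?R > 0" using less d(1) by (metis le_less_trans zero_less_mult_pos)
      \<comment> \<open>Scaling by the Bochner norm, which is positive here, rather than by
        \<open>Phi\<close>, which may vanish: the scaled function has \<open>Phi\<close> below
        \<open>d\<close> but its image has Bochner norm exactly 1.\<close>
      let ?g = "\<lambda>w. (1 / ?R) *\<^sub>R f w"
      have "Phi p \<sigma> M ?g \<le> 1 / ?R * ?S"
        using R p by (intro Phi_scaleR_le fin f \<sigma>) auto
      also have "\<dots> < d" using less R by (simp add: field_simps)
      finally have "bochner_norm p M (\<lambda>w. u (?g w)) < 1"
        by (intro small simple_function_compose1[OF f])
      moreover have "bochner_norm p M (\<lambda>w. u (?g w)) = 1 / ?R * ?R"
      proof -
        have "(LINT w|M. norm (u (?g w)) powr p) = (1 / ?R) powr p * (LINT w|M. norm (u (f w)) powr p)"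
          using R by (simp add: linear_scale[OF u] powr_mult powr_divide)
        then show ?thesis
          using R p unfolding bochner_norm_def[of p M "\<lambda>w. u (?g w)"]
          by (simp add: powr_mult powr_inverse_powr bochner_norm_def)
      qed
      ultimately show False using R by simp
    qed
  qed
qed

theorem theorem5:
  fixes M :: "'w measure" and u :: "'a::banach \<Rightarrow> 'b::banach" and \<sigma> :: real
  assumes "finite_measure M" and "nonatomic M" and "emeasure M (space M) > 0"
    and "0 \<le> \<sigma>" and "\<sigma> < 1"
    and "bounded_linear u"
  shows "absolutely_continuous_op 1 \<sigma> u \<longleftrightarrow>
    (\<forall>f \<in> pettis_sigma_space (1 / (1 - \<sigma>)) \<sigma> M. u \<circ> f \<in> bochner_space (1 / (1 - \<sigma>)) M) \<and>
    norm_continuous_on (pettis_sigma_space (1 / (1 - \<sigma>)) \<sigma> M)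
      (pettis_sigma_norm (1 / (1 - \<sigma>)) \<sigma> M) (bochner_norm (1 / (1 - \<sigma>)) M) (\<lambda>f. u \<circ> f)"
proof -
  define p where "p = 1 / (1 - \<sigma>)"
  have p: "1 \<le> p" "0 < p" and \<sigma>: "\<sigma> \<le> 1" using assms(4,5) by (auto simp: p_def)
  have lin: "linear u" using assms(6) by (rule bounded_linear.linear)
  note ac_iff = absolutely_continuous_op_1_iff[OF p_def, of u]
  show ?thesis
    unfolding p_def[symmetric]
  proof (intro iffI conjI ballI)
    assume "absolutely_continuous_op 1 \<sigma> u"
    then obtain C where C: "C > 0" "\<And>(n::nat) x. (\<Sum>i<n. norm (u (x i)) powr p) powr (1 / p)
        \<le> C * (SUP x'\<in>cball 0 1. (\<Sum>i<n. sigma_weight p \<sigma> x' (x i)) powr (1 / p))"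
      unfolding ac_iff by blast
    note bound = bochner_norm_le_Phi[OF assms(1) p(2) lin C(2)]
    show "u \<circ> f \<in> bochner_space p M" if "f \<in> pettis_sigma_space p \<sigma> M" for f
      using composition_well_defined[OF assms(1,4) \<sigma> p(1) assms(6) C(1) bound that] .
    show "norm_continuous_on (pettis_sigma_space p \<sigma> M) (pettis_sigma_norm p \<sigma> M) (bochner_norm p M) (\<lambda>f. u \<circ> f)"
      using composition_continuous[OF assms(1,4) \<sigma> p(1) assms(6) C(1) bound] .
  next
    assume "(\<forall>f\<in>pettis_sigma_space p \<sigma> M. u \<circ> f \<in> bochner_space p M) \<and>
      norm_continuous_on (pettis_sigma_space p \<sigma> M) (pettis_sigma_norm p \<sigma> M) (bochner_norm p M) (\<lambda>f. u \<circ> f)"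
    then obtain C where C: "C > 0"
      "\<And>f. simple_function M f \<Longrightarrow> bochner_norm p M (\<lambda>w. u (f w)) \<le> C * Phi p \<sigma> M f"
      using bochner_norm_le_Phi_of_continuous[OF assms(1,4) \<sigma> p(1) lin] by blast
    \<comment> \<open>The vectors are realised by a simple function whose Bochner norm and
      \<open>Phi\<close> are the two sides of the inequality, up to the factor
      \<open>C\<close>.\<close>
    have "(\<Sum>i<n. norm (u (x i)) powr p) powr (1 / p)
        \<le> C * (SUP x'\<in>cball 0 1. (\<Sum>i<n. sigma_weight p \<sigma> x' (x i)) powr (1 / p))" for n :: nat and x
      by (rule ex_simple_function_sums[OF assms(1-3) p(2) lin, of x n \<sigma>]) (use C(2) in metis)
    with C(1) lin show "absolutely_continuous_op 1 \<sigma> u" unfolding ac_iff by blast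
  qed
qed

end
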